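(* Let $\mathbb{F}$ be a field and $n$ a positive integer. Let $u$ and $v$ be locally nilpotent linear representations of the cyclic quiver $\mathcal{C}_n$ over $\mathbb{F}$ with countable dimension. Then $u$ and $v$ are isomorphic if and only if $\kappa_{k,\alpha}(u)=\kappa_{k,\alpha}(v)$ for all $k \in \mathbb{Z}/n$ and all $\alpha \in \omega_1 \cup \{\infty\}$.
   Context: $\omega_1$ is the first uncountable ordinal (the set of all countable ordinals); $\infty$ is a symbol that is not an ordinal. "Countable" means of cardinality at most $\aleph_0$. A linear representation of $\mathcal{C}_n$ (an $n$-cycle of linear mappings) is a family $u=(U_k,u_k)_{k\in\mathbb{Z}/n}$ where each $U_k$ is an $\mathbb{F}$-vector space and $u_k:U_k\to U_{k+1}$ is linear. Its dimension is $\sum_k \dim U_k$. An isomorphism from $(U_k,u_k)_k$ to $(V_k,v_k)_k$ is a family of linear isomorphisms $\varphi_k:U_k\to V_k$ ($k\in\mathbb{Z}/n$) with $v_k\circ\varphi_k=\varphi_{k+1}\circ u_k$ for all $k$. Put $(\pi u)_k:=u_{k+n-1}\circ\cdots\circ u_{k+1}\circ u_k$, an endomorphism of $U_k$. The representation $u$ is locally nilpotent if for every $x\in U_0$ there is an integer $i\ge 0$ with $((\pi u)_0)^i(x)=0$ (equivalently, the same holds for every $k$ in place of $0$). For every ordinal $\alpha$ and $k\in\mathbb{Z}/n$ define linear subspaces $U_{k,\alpha}$ of $U_k$ by transfinite induction: $U_{k,0}:=U_k$; $U_{k,\alpha+1}:=u_{k-1}(U_{k-1,\alpha})$; $U_{k,\alpha}:=\bigcap_{\beta<\alpha}U_{k,\beta}$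 for $\alpha$ a limit ordinal. These are non-increasing in $\alpha$. Put $U_{k,\infty}:=\bigcap_\alpha U_{k,\alpha}$ (over all ordinals). For an ordinal $\alpha$, the map $u_k$ induces a surjective linear map $u_{k,\alpha}:U_{k,\alpha}/U_{k,\alpha+1}\to U_{k+1,\alpha+1}/U_{k+1,\alpha+2}$, and the Kaplansky invariant is the cardinal $\kappa_{k,\alpha}(u):=\dim(\ker u_{k,\alpha})$. Moreover $\kappa_{k,\infty}(u):=\dim(U_{k,\infty}\cap\ker u_k)$. *)

theory Defs
  imports Complex_Main "HOL-Library.Countable_Set"
begin

unbundle cardinal_syntax

section \<open>Ordinals\<close>

text \<open>
  The ordinals smaller than the successor cardinal of the cardinality of \<^typ>\<open>'a\<close>.  For
  \<^typ>\<open>'a\<close> countably infinite this is the set \<open>\<omega>\<^sub>1\<close> of the countable ordinals.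
\<close>

typedef 'a ord_below = "Field (cardSuc |UNIV :: 'a set| )"
proof -
  have "|UNIV :: 'a set| <o cardSuc |UNIV :: 'a set|"
    by (rule cardSuc_greater[OF card_of_Card_order])
  moreover have "|Field (cardSuc |UNIV :: 'a set| )| =o cardSuc |UNIV :: 'a set|"
    by (intro card_of_Field_ordIso cardSuc_Card_order card_of_Card_order)
  ultimately have "|UNIV :: 'a set| \<le>o |Field (cardSuc |UNIV :: 'a set| )|"
    by (meson ordIso_symmetric ordLess_imp_ordLeq ordLeq_ordIso_trans)
  then have "Field (cardSuc |UNIV :: 'a set| ) \<noteq> {}"
    using card_of_empty3 by fastforce
  then show ?thesis by blast
qed

lemma Well_order_cardSuc_UNIV: "Well_order (cardSuc |UNIV :: 'a set| )"
  using cardSuc_Card_order[OF card_of_Card_order] card_order_on_well_order_on by blast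

instantiation ord_below :: (type) wellorder
begin

definition less_eq_ord_below :: "'a ord_below \<Rightarrow> 'a ord_below \<Rightarrow> bool"
  where "x \<le> y \<longleftrightarrow> (Rep_ord_below x, Rep_ord_below y) \<in> cardSuc |UNIV :: 'a set|"

definition less_ord_below :: "'a ord_below \<Rightarrow> 'a ord_below \<Rightarrow> bool"
  where "(x :: 'a ord_below) < y \<longleftrightarrow> x \<le> y \<and> x \<noteq> y"

instance
proof
  let ?r = "cardSuc |UNIV :: 'a set|"
  have lin: "Linear_order ?r" and wf: "wf (?r - Id)"
    using Well_order_cardSuc_UNIV[where 'a='a] unfolding well_order_on_def by auto
  have refl: "refl_on (Field ?r) ?r" and trans: "trans ?r" and antisym: "antisym ?r"
    and total: "total_on (Field ?r) ?r"
    using lin unfolding linear_order_on_def partial_order_on_def preorder_on_def by auto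
  fix x y z :: "'a ord_below"
  show r: "x \<le> x"
    using refl Rep_ord_below[of x] by (auto simp: less_eq_ord_below_def refl_on_def)
  show "x \<le> y \<Longrightarrow> y \<le> z \<Longrightarrow> x \<le> z"
    using trans by (auto simp: less_eq_ord_below_def dest: transD)
  show as: "x \<le> y \<Longrightarrow> y \<le> x \<Longrightarrow> x = y"
    using antisym by (auto simp: less_eq_ord_below_def Rep_ord_below_inject dest: antisymD)
  show "x < y \<longleftrightarrow> x \<le> y \<and> \<not> y \<le> x"
    using r as by (auto simp: less_ord_below_def)
  show "x \<le> y \<or> y \<le> x"
    using total Rep_ord_below[of x] Rep_ord_below[of y] r
    by (cases "x = y") (auto simp: less_eq_ord_below_def total_on_def Rep_ord_below_inject)
  fix P :: "'a ord_below \<Rightarrow> bool" and a :: "'a ord_below"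
  assume step: "\<And>x. (\<And>y. y < x \<Longrightarrow> P y) \<Longrightarrow> P x"
  have "wf (inv_image (?r - Id) Rep_ord_below)"
    using wf by (rule wf_inv_image)
  then show "P a"
  proof (induction a)
    case (less x)
    then show ?case
      by (rule step) (auto simp: less_ord_below_def less_eq_ord_below_def inv_image_def
          Rep_ord_below_inject)
  qed
qed

end

type_synonym omega1 = "nat ord_below"

lemma no_inj_ord_below: "\<not> inj (f :: 'a ord_below \<Rightarrow> 'a)"
proof
  let ?r = "cardSuc |UNIV :: 'a set|"
  assume "inj f"
  then have "inj_on (f \<circ> Abs_ord_below) (Field ?r)"
    by (intro comp_inj_on) (auto intro!: inj_onI simp: Abs_ord_below_inject dest: injD)
  then have "|Field ?r| \<le>o |UNIV :: 'a set|"
    using card_of_ordLeq by blast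
  moreover have "|Field ?r| =o ?r"
    by (intro card_of_Field_ordIso cardSuc_Card_order card_of_Card_order)
  moreover have "|UNIV :: 'a set| <o ?r"
    by (rule cardSuc_greater[OF card_of_Card_order])
  ultimately show False
    by (meson not_ordLess_ordLeq ordIso_iff_ordLeq ordIso_ordLeq_trans ordIso_symmetric)
qed

text \<open>Uncountable with countable proper initial segments: \<^typ>\<open>omega1\<close> is \<open>\<omega>\<^sub>1\<close>.\<close>

lemma uncountable_omega1: "uncountable (UNIV :: omega1 set)"
proof
  assume "countable (UNIV :: omega1 set)"
  then obtain f :: "omega1 \<Rightarrow> nat" where "inj f"
    by (rule countableE)
  then show False
    by (rule no_inj_ord_below[THEN notE])
qed

lemma countable_lessThan_omega1: "countable {..<\<alpha> :: omega1}"
proof -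
  let ?r = "cardSuc |UNIV :: nat set|"
  let ?a = "Rep_ord_below \<alpha>"
  have "|underS ?r ?a| <o ?r"
    by (intro card_of_underS cardSuc_Card_order card_of_Card_order Rep_ord_below)
  then have "|underS ?r ?a| \<le>o |UNIV :: nat set|"
    by (rule iffD1[OF cardSuc_ordLeq_ordLess[OF card_of_Card_order card_of_Card_order]])
  then have "countable (underS ?r ?a)"
    by (meson card_of_ordLeq countable_def subset_UNIV)
  moreover have "Rep_ord_below ` {..<\<alpha>} \<subseteq> underS ?r ?a"
    by (auto simp: underS_def less_ord_below_def less_eq_ord_below_def Rep_ord_below_inject)
  ultimately have "countable (Rep_ord_below ` {..<\<alpha>})"
    by (rule countable_subset[rotated])
  then show ?thesis
    by (meson countable_image_inj_on inj_onI Rep_ord_below_inject)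
qed


section \<open>Dimensions as cardinals\<close>

definition cdim :: "('f::field \<Rightarrow> 'a::ab_group_add \<Rightarrow> 'a) \<Rightarrow> 'a set \<Rightarrow> 'a rel"
  where "cdim scale S =
    |SOME B. B \<subseteq> S \<and> \<not> module.dependent scale B \<and> module.span scale B = S|"

definition coset :: "'a::ab_group_add set \<Rightarrow> 'a \<Rightarrow> 'a set"
  where "coset W x = {x + w | w. w \<in> W}"

definition quotient_space :: "'a::ab_group_add set \<Rightarrow> 'a set \<Rightarrow> 'a set set"
  where "quotient_space V W = coset W ` V"

text \<open>
  For a finite set \<open>S\<close> of cosets of \<open>W\<close>, the linear combination of the elements of \<open>S\<close> with
  coefficients \<open>c\<close> in the quotient space by \<open>W\<close>.  For \<open>S = {}\<close> it is the zero coset \<open>W\<close>.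
\<close>

definition coset_comb ::
    "('f::field \<Rightarrow> 'a::ab_group_add \<Rightarrow> 'a) \<Rightarrow> 'a set \<Rightarrow> 'a set set \<Rightarrow> ('a set \<Rightarrow> 'f) \<Rightarrow> 'a set"
  where "coset_comb scale W S c =
    {(\<Sum>C\<in>S. scale (c C) (r C)) + w | r w. (\<forall>C\<in>S. r C \<in> C) \<and> w \<in> W}"

text \<open>
  \<open>B\<close> is a basis of \<open>Q\<close>, where \<open>Q\<close> is a linear subspace of a quotient space by \<open>W\<close>.
\<close>

definition coset_basis ::
    "('f::field \<Rightarrow> 'a::ab_group_add \<Rightarrow> 'a) \<Rightarrow> 'a set \<Rightarrow> 'a set set \<Rightarrow> 'a set set \<Rightarrow> bool"
  where "coset_basis scale W Q B \<longleftrightarrow> B \<subseteq> Q \<and>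
    (\<forall>S c. finite S \<and> S \<subseteq> B \<and> coset_comb scale W S c = W \<longrightarrow> (\<forall>C\<in>S. c C = 0)) \<and>
    (\<forall>C\<in>Q. \<exists>S c. finite S \<and> S \<subseteq> B \<and> C = coset_comb scale W S c)"

definition coset_cdim ::
    "('f::field \<Rightarrow> 'a::ab_group_add \<Rightarrow> 'a) \<Rightarrow> 'a set \<Rightarrow> 'a set set \<Rightarrow> 'a set rel"
  where "coset_cdim scale W Q = |SOME B. coset_basis scale W Q B|"


section \<open>Cycles of linear mappings\<close>

definition linear_map_on ::
    "('f \<Rightarrow> 'a \<Rightarrow> 'a) \<Rightarrow> ('f \<Rightarrow> 'b \<Rightarrow> 'b) \<Rightarrow> 'a::ab_group_add set \<Rightarrow> 'b::ab_group_add set \<Rightarrow> ('a \<Rightarrow> 'b) \<Rightarrow> bool"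
  where "linear_map_on scaleA scaleB S T f \<longleftrightarrow>
    (\<forall>x\<in>S. f x \<in> T) \<and>
    (\<forall>x\<in>S. \<forall>y\<in>S. f (x + y) = f x + f y) \<and>
    (\<forall>c. \<forall>x\<in>S. f (scaleA c x) = scaleB c (f x))"

text \<open>
  The elements of \<open>\<int>/n\<close> are represented by \<open>0, \<dots>, n - 1\<close>, and the spaces \<open>U\<^sub>k\<close> by subspaces of
  one vector space (such as the direct sum of all of them).  Only the values of \<open>u k\<close> on \<open>U k\<close>
  matter.
\<close>

locale cyclic_rep = vector_space scale
  for scale :: "'f::field \<Rightarrow> 'a::ab_group_add \<Rightarrow> 'a" +
  fixes n :: nat and U :: "nat \<Rightarrow> 'a set" and u :: "nat \<Rightarrow> 'a \<Rightarrow> 'a"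
  assumes n_pos: "n > 0"
    and subspace_U: "k < n \<Longrightarrow> subspace (U k)"
    and linear_u: "k < n \<Longrightarrow> linear_map_on scale scale (U k) (U ((k + 1) mod n)) (u k)"
begin

definition dimension :: "(nat \<times> 'a) rel"
  where "dimension = BNF_Cardinal_Arithmetic.Csum |{..<n}| (\<lambda>k. cdim scale (U k))"

text \<open>\<open>u_path k m\<close> is the composition of the \<open>m\<close> consecutive maps starting at the vertex \<open>k\<close>.\<close>

primrec u_path :: "nat \<Rightarrow> nat \<Rightarrow> 'a \<Rightarrow> 'a"
  where
    "u_path k 0 = id"
  | "u_path k (Suc m) = u ((k + m) mod n) \<circ> u_path k m"

definition loop :: "nat \<Rightarrow> 'a \<Rightarrow> 'a"
  where "loop k = u_path k n"

definition locally_nilpotent :: bool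
  where "locally_nilpotent \<longleftrightarrow> (\<forall>x\<in>U 0. \<exists>i. (loop 0 ^^ i) x = 0)"

definition shift :: "(nat \<Rightarrow> 'a set) \<Rightarrow> nat \<Rightarrow> 'a set"
  where "shift W k = u ((k + n - 1) mod n) ` W ((k + n - 1) mod n)"

text \<open>
  \<open>U_ord \<alpha> k\<close> is \<open>U\<^bsub>k,\<alpha>\<^esub>\<close>, for \<open>\<alpha>\<close> in any type of ordinals.  The condition
  \<open>{..<\<alpha>} = {..\<beta>}\<close> means that \<open>\<alpha>\<close> is the successor of \<open>\<beta>\<close>.
\<close>

function U_ord :: "'o::wellorder \<Rightarrow> nat \<Rightarrow> 'a set"
  where "U_ord \<alpha> =
    (if {..<\<alpha>} = {} then U
     else if \<exists>\<beta>. {..<\<alpha>} = {..\<beta>} then shift (U_ord (THE \<beta>. {..<\<alpha>} = {..\<beta>}))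
     else (\<lambda>k. \<Inter>\<beta>\<in>{..<\<alpha>}. U_ord \<beta> k))"
  by pat_completeness auto
termination
proof (relation "{(x, y). x < y}")
  show "wf {(x :: 'o::wellorder, y). x < y}"
    by (rule wf)
next
  fix \<alpha> :: "'o::wellorder"
  assume "\<exists>\<beta>. {..<\<alpha>} = {..\<beta>}"
  then obtain \<beta> where b: "{..<\<alpha>} = {..\<beta>}" by blast
  then have "(THE \<beta>. {..<\<alpha>} = {..\<beta>}) = \<beta>" by auto
  with b show "((THE \<beta>. {..<\<alpha>} = {..\<beta>}), \<alpha>) \<in> {(x, y). x < y}" by auto
qed auto

declare U_ord.simps [simp del]

text \<open>
  The families \<open>(U\<^bsub>k,\<alpha>\<^esub>)\<^sub>k\<close> cannot strictly decrease along all the ordinals below the cardinal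
  successor of \<^typ>\<open>nat \<times> 'a\<close>, so the intersection over these is the intersection over all
  ordinals; see \<open>U_inf_subset_U_ord\<close>.
\<close>

definition U_inf :: "nat \<Rightarrow> 'a set"
  where "U_inf k = (\<Inter>\<alpha> :: (nat \<times> 'a) ord_below. U_ord \<alpha> k)"

lemma shift_mono: "(\<And>k. k < n \<Longrightarrow> W k \<subseteq> W' k) \<Longrightarrow> shift W k \<subseteq> shift W' k"
  unfolding shift_def using n_pos by (intro image_mono) simp

lemma shift_subset: "(\<And>k. k < n \<Longrightarrow> W k \<subseteq> U k) \<Longrightarrow> k < n \<Longrightarrow> shift W k \<subseteq> U k"
proof -
  assume W: "\<And>k. k < n \<Longrightarrow> W k \<subseteq> U k" and k: "k < n"
  let ?j = "(k + n - 1) mod n"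
  have "?j < n" using n_pos by simp
  moreover have "(?j + 1) mod n = k"
    using k n_pos by (simp add: mod_Suc_eq)
  ultimately show "shift W k \<subseteq> U k"
    using W linear_u[of ?j] unfolding shift_def linear_map_on_def by auto
qed

lemma U_ord_zero: "{..<\<alpha>} = {} \<Longrightarrow> U_ord \<alpha> = U"
  by (subst U_ord.simps) simp

lemma U_ord_succ:
  assumes "{..<\<alpha>} = {..\<beta>}"
  shows "U_ord \<alpha> = shift (U_ord \<beta>)"
proof -
  have "(THE \<beta>. {..<\<alpha>} = {..\<beta>}) = \<beta>" "{..<\<alpha>} \<noteq> {}" using assms by auto
  then show ?thesis using assms by (subst U_ord.simps) auto
qed

lemma U_ord_limit:
  assumes "{..<\<alpha>} \<noteq> {}" "\<And>\<beta>. {..<\<alpha>} \<noteq> {..\<beta>}"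
  shows "U_ord \<alpha> k = (\<Inter>\<beta>\<in>{..<\<alpha>}. U_ord \<beta> k)"
  using assms by (subst U_ord.simps) auto

lemma U_ord_antimono: "\<beta> \<le> \<alpha> \<Longrightarrow> k < n \<Longrightarrow> U_ord \<alpha> k \<subseteq> U_ord \<beta> k"
  and shift_U_ord_subset: "k < n \<Longrightarrow> shift (U_ord \<alpha>) k \<subseteq> U_ord \<alpha> k"
proof -
  have "\<forall>k<n. (\<forall>\<beta>\<le>\<alpha>. U_ord \<alpha> k \<subseteq> U_ord \<beta> k) \<and> shift (U_ord \<alpha>) k \<subseteq> U_ord \<alpha> k
    \<and> U_ord \<alpha> k \<subseteq> U k" for \<alpha> :: "'o::wellorder"
  proof (induction \<alpha> rule: less_induct)
    case (less \<alpha>)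
    note IH1 = less.IH[rule_format, THEN conjunct1, rule_format]
    note IH2 = less.IH[rule_format, THEN conjunct2, THEN conjunct1]
    note IH3 = less.IH[rule_format, THEN conjunct2, THEN conjunct2]
    consider "{..<\<alpha>} = {}" | \<gamma> where "{..<\<alpha>} = {..\<gamma>}"
      | "{..<\<alpha>} \<noteq> {}" "\<And>\<beta>. {..<\<alpha>} \<noteq> {..\<beta>}"
      by blast
    then show ?case
    proof cases
      case 1
      then have "\<beta> \<le> \<alpha> \<Longrightarrow> \<beta> = \<alpha>" for \<beta>
        by (metis empty_iff lessThan_iff order_le_less)
      then have "\<beta> \<le> \<alpha> \<Longrightarrow> U_ord \<alpha> k \<subseteq> U_ord \<beta> k" for \<beta> k
        by blast
      then show ?thesis using 1 shift_subset[of U] by (simp add: U_ord_zero)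
    next
      case (2 \<gamma>)
      then have iff: "\<beta> < \<alpha> \<longleftrightarrow> \<beta> \<le> \<gamma>" for \<beta>
        by (metis atMost_iff lessThan_iff)
      then have \<gamma>: "\<gamma> < \<alpha>" and le: "\<beta> \<le> \<alpha> \<Longrightarrow> \<beta> = \<alpha> \<or> \<beta> \<le> \<gamma>" for \<beta>
        by (blast, metis order_le_less)
      have sub: "k < n \<Longrightarrow> U_ord \<alpha> k \<subseteq> U_ord \<gamma> k" for k
        using IH2[OF \<gamma>] by (simp add: U_ord_succ[OF 2])
      have "shift (U_ord \<alpha>) k \<subseteq> shift (U_ord \<gamma>) k" for k
        by (rule shift_mono[OF sub])
      then have "shift (U_ord \<alpha>) k \<subseteq> U_ord \<alpha> k" for k
        by (simp only: U_ord_succ[OF 2, symmetric])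
      moreover have "U_ord \<alpha> k \<subseteq> U_ord \<beta> k" if "k < n" "\<beta> \<le> \<alpha>" for k \<beta>
        using le[OF that(2)]
      proof
        assume "\<beta> \<le> \<gamma>"
        then have "U_ord \<gamma> k \<subseteq> U_ord \<beta> k"
          by (rule IH1[OF \<gamma> that(1)])
        with sub[OF that(1)] show ?thesis by (rule subset_trans)
      qed simp
      moreover have "k < n \<Longrightarrow> U_ord \<alpha> k \<subseteq> U k" for k
        by (rule subset_trans[OF sub IH3[OF \<gamma>]])
      ultimately show ?thesis by blast
    next
      case 3
      note lim = U_ord_limit[OF 3]
      have sub: "\<beta> < \<alpha> \<Longrightarrow> U_ord \<alpha> k \<subseteq> U_ord \<beta> k" for \<beta> k
        unfolding lim by blast
      have sh: "shift (U_ord \<alpha>) k \<subseteq> U_ord \<beta> k" if "\<beta> < \<alpha>" "k < n" for \<beta> k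
      proof -
        have "shift (U_ord \<alpha>) k \<subseteq> shift (U_ord \<beta>) k"
          by (rule shift_mono[OF sub[OF that(1)]])
        also have "\<dots> \<subseteq> U_ord \<beta> k"
          by (rule IH2[OF that])
        finally show ?thesis .
      qed
      obtain \<beta> where "\<beta> < \<alpha>" using 3(1) by auto
      then have "U_ord \<alpha> k \<subseteq> U k" if "k < n" for k
        using subset_trans[OF sub IH3] that by simp
      moreover have "k < n \<Longrightarrow> shift (U_ord \<alpha>) k \<subseteq> U_ord \<alpha> k" for k
        unfolding lim[of k] by (intro INT_greatest sh) simp_all
      moreover have "\<beta> \<le> \<alpha> \<Longrightarrow> U_ord \<alpha> k \<subseteq> U_ord \<beta> k" for \<beta> k
        using sub by (cases "\<beta> = \<alpha>") simp_all
      ultimately show ?thesis by blast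
    qed
  qed
  then show "\<beta> \<le> \<alpha> \<Longrightarrow> k < n \<Longrightarrow> U_ord \<alpha> k \<subseteq> U_ord \<beta> k"
    "k < n \<Longrightarrow> shift (U_ord \<alpha>) k \<subseteq> U_ord \<alpha> k"
    by blast+
qed

lemma shift_stable_subset_U_ord:
  assumes "\<And>k. k < n \<Longrightarrow> W k \<subseteq> U k" "\<And>k. k < n \<Longrightarrow> W k \<subseteq> shift W k"
  shows "k < n \<Longrightarrow> W k \<subseteq> U_ord \<alpha> k"
proof (induction \<alpha> arbitrary: k rule: less_induct)
  case (less \<alpha>)
  consider "{..<\<alpha>} = {}" | \<gamma> where "{..<\<alpha>} = {..\<gamma>}"
    | "{..<\<alpha>} \<noteq> {}" "\<And>\<beta>. {..<\<alpha>} \<noteq> {..\<beta>}"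
    by blast
  then show ?case
  proof cases
    case 1
    then show ?thesis using assms(1) less.prems by (simp add: U_ord_zero)
  next
    case (2 \<gamma>)
    then have "\<gamma> < \<alpha>" by auto
    then have "shift W k \<subseteq> shift (U_ord \<gamma>) k"
      using less.IH by (intro shift_mono) blast
    then show ?thesis
      using assms(2)[OF less.prems] by (simp add: U_ord_succ[OF 2])
  next
    case 3
    then show ?thesis using less by (auto simp: U_ord_limit[OF 3])
  qed
qed

lemma U_ord_stabilizes:
  "\<exists>\<alpha> :: (nat \<times> 'a) ord_below. \<forall>k<n. shift (U_ord \<alpha>) k = U_ord \<alpha> k"
proof (rule ccontr)
  assume "\<not> ?thesis"
  then have "\<forall>\<alpha> :: (nat \<times> 'a) ord_below. \<exists>q :: nat \<times> 'a.
      fst q < n \<and> snd q \<in> U_ord \<alpha> (fst q) \<and> snd q \<notin> shift (U_ord \<alpha>) (fst q)"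
    using shift_U_ord_subset by fastforce
  then obtain p where p: "\<And>\<alpha> :: (nat \<times> 'a) ord_below.
      fst (p \<alpha>) < n \<and> snd (p \<alpha>) \<in> U_ord \<alpha> (fst (p \<alpha>)) \<and> snd (p \<alpha>) \<notin> shift (U_ord \<alpha>) (fst (p \<alpha>))"
    by (metis (no_types))
  have below: "U_ord \<beta> k \<subseteq> shift (U_ord \<alpha>) k" if "\<alpha> < \<beta>" "k < n"
    for \<alpha> \<beta> :: "(nat \<times> 'a) ord_below" and k
  proof -
    define \<gamma> where "\<gamma> = (LEAST \<gamma>. \<alpha> < \<gamma>)"
    have "\<alpha> < \<gamma>" "\<gamma> \<le> \<beta>"
      unfolding \<gamma>_def using that(1) by (auto intro: LeastI Least_le)
    moreover from this have "{..<\<gamma>} = {..\<alpha>}"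
      unfolding \<gamma>_def
      by (auto simp: not_less[symmetric] dest: not_less_Least[where P = "\<lambda>\<gamma>. \<alpha> < \<gamma>"])
    ultimately show ?thesis
      using U_ord_antimono[of \<gamma> \<beta> k] that(2) by (simp add: U_ord_succ)
  qed
  have "p \<alpha> \<noteq> p \<beta>" if "\<alpha> < \<beta>" for \<alpha> \<beta>
    using below[OF that, of "fst (p \<beta>)"] p[of \<alpha>] p[of \<beta>] by auto
  then have "inj p"
    by (metis injI neq_iff)
  then show False
    using no_inj_ord_below by blast
qed

lemma U_inf_subset_U_ord: "k < n \<Longrightarrow> U_inf k \<subseteq> U_ord \<alpha> k"
proof -
  assume k: "k < n"
  obtain \<alpha>\<^sub>0 :: "(nat \<times> 'a) ord_below" where st: "\<forall>k<n. shift (U_ord \<alpha>\<^sub>0) k = U_ord \<alpha>\<^sub>0 k"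
    using U_ord_stabilizes by blast
  define z where "z = (LEAST z :: (nat \<times> 'a) ord_below. True)"
  have "{..<z} = {}"
    unfolding z_def using not_less_Least by auto
  then have "k < n \<Longrightarrow> U_ord \<alpha>\<^sub>0 k \<subseteq> U k" for k
    using U_ord_antimono[of z \<alpha>\<^sub>0 k] Least_le[of "\<lambda>_. True" \<alpha>\<^sub>0] unfolding z_def
    by (simp add: U_ord_zero)
  then have "U_ord \<alpha>\<^sub>0 k \<subseteq> U_ord \<alpha> k"
    using st k by (intro shift_stable_subset_U_ord) auto
  then show ?thesis unfolding U_inf_def by blast
qed

text \<open>
  The kernel of the map from \<open>W\<^sub>k / W'\<^sub>k\<close> to \<open>W'\<^bsub>k+1\<^esub> / W''\<^bsub>k+1\<^esub>\<close> induced by \<open>u\<^sub>k\<close>, where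
  \<open>W' = shift W\<close> and \<open>W'' = shift W'\<close>.  A coset \<open>C\<close> is mapped to \<open>u\<^sub>k(C) + W''\<^bsub>k+1\<^esub>\<close>.
\<close>

definition induced :: "(nat \<Rightarrow> 'a set) \<Rightarrow> nat \<Rightarrow> 'a set \<Rightarrow> 'a set"
  where "induced W k C = {u k x + w | x w. x \<in> C \<and> w \<in> shift (shift W) ((k + 1) mod n)}"

definition induced_kernel :: "(nat \<Rightarrow> 'a set) \<Rightarrow> nat \<Rightarrow> 'a set set"
  where "induced_kernel W k =
    {C \<in> quotient_space (W k) (shift W k). induced W k C = shift (shift W) ((k + 1) mod n)}"

definition kappa :: "nat \<Rightarrow> 'o::wellorder \<Rightarrow> 'a set rel"
  where "kappa k \<alpha> = coset_cdim scale (shift (U_ord \<alpha>) k) (induced_kernel (U_ord \<alpha>) k)"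

definition kappa_inf :: "nat \<Rightarrow> 'a rel"
  where "kappa_inf k = cdim scale (U_inf k \<inter> {x. u k x = 0})"

end

definition cyclic_rep_isomorphic ::
    "nat \<Rightarrow> ('f \<Rightarrow> 'a::ab_group_add \<Rightarrow> 'a) \<Rightarrow> (nat \<Rightarrow> 'a set) \<Rightarrow> (nat \<Rightarrow> 'a \<Rightarrow> 'a) \<Rightarrow>
     ('f \<Rightarrow> 'b::ab_group_add \<Rightarrow> 'b) \<Rightarrow> (nat \<Rightarrow> 'b set) \<Rightarrow> (nat \<Rightarrow> 'b \<Rightarrow> 'b) \<Rightarrow> bool"
  where "cyclic_rep_isomorphic n scaleU U u scaleV V v \<longleftrightarrow>
    (\<exists>\<phi>. \<forall>k<n. linear_map_on scaleU scaleV (U k) (V k) (\<phi> k) \<and> bij_betw (\<phi> k) (U k) (V k) \<and>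
      (\<forall>x\<in>U k. v k (\<phi> k x) = \<phi> ((k + 1) mod n) (u k x)))"

end

theory Submission
  imports Defs "HOL-Library.Countable_Set_Type"
begin

text \<open>
  For the direction from the invariants to an isomorphism, partial isomorphisms between finite
  dimensional subrepresentations, represented by their graphs, are extended by one vector at a time
  in a back-and-forth construction; they preserve membership in all \<open>U\<^bsub>k,\<alpha>\<^esub>\<close> with \<open>\<alpha> \<in> \<omega>\<^sub>1\<close>
  (Kaplansky and Mackey's proof of Ulm's theorem).  Let \<open>S\<close> be the domain at the vertex \<open>k\<close> and
  \<open>u\<^sub>k x\<close> already in the domain at \<open>k + 1\<close>.  Since \<open>S\<close> is finite dimensional, \<open>x\<close> can be taken of
  maximal height \<open>\<beta>\<close> in \<open>x + S\<close>.  If no \<open>u\<^sub>k(x + s)\<close> with \<open>s \<in> S \<inter> U\<^bsub>k,\<beta>\<^esub>\<close> lies in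
  \<open>U\<^bsub>k+1,\<beta>+2\<^esub>\<close>, any preimage of the image of \<open>u\<^sub>k x\<close> of height at least \<open>\<beta>\<close> is a partner of \<open>x\<close>.
  Otherwise \<open>x\<close> can be corrected, modulo \<open>S\<close> and \<open>U\<^bsub>k,\<beta>+1\<^esub>\<close>, to an element of the kernel of
  \<open>u\<^sub>k\<close> outside of the subspace given by \<open>S\<close>, and equality of \<open>\<kappa>\<^bsub>k,\<beta>\<^esub>\<close> leaves room for a partner.
  Infinite height is treated in the same way with \<open>\<kappa>\<^bsub>k,\<infinity>\<^esub>\<close>.  By local nilpotency, finitely many
  such steps add any given vector, and countably many steps exhaust both representations.
\<close>

section \<open>Vector spaces\<close>

context vector_space
begin

text \<open>A basis \<open>A'\<close> chosen inside \<open>A\<close> and a basis \<open>B'\<close>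
  containing \<open>B\<close> span the same subspace, so they are equipotent; and \<open>A'\<close>
  is countable.\<close>

lemma countable_independent:
  assumes "independent B" "B \<subseteq> span A" "countable A"
  shows "countable B"
proof -
  obtain A' where A': "A' \<subseteq> A" "independent A'" "A \<subseteq> span A'"
    by (rule maximal_independent_subset)
  obtain B' where B': "B \<subseteq> B'" "B' \<subseteq> span A" "independent B'" "span A \<subseteq> span B'"
    by (rule maximal_independent_subset_extend[OF assms(2,1)])
  have "span A' = span B'"
    using A' B' by (meson span_minimal span_mono subspace_span subset_antisym subset_trans)
  then obtain f where "bij_betw f A' B'"
    using bij_if_span_eq_span_bases[OF A'(2) B'(3)] by blast
  moreover have "countable A'"
    using A'(1) assms(3) by (rule countable_subset)
  ultimately have "countable B'"
    by (metis bij_betw_def countable_image)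
  then show ?thesis
    using B'(1) countable_subset by blast
qed

lemma ordIso_of_bases:
  assumes "independent A" "independent B" "span A = span B"
  shows "|A| =o |B|"
  using bij_if_span_eq_span_bases[OF assms] card_of_ordIso by blast

lemma basis_of_subspace:
  assumes "subspace S"
  obtains B where "B \<subseteq> S" "independent B" "span B = S"
proof -
  obtain B where "B \<subseteq> S" "independent B" "S \<subseteq> span B"
    by (rule maximal_independent_subset)
  with assms show thesis
    using that span_subspace by blast
qed

text \<open>\<open>cdim\<close> refers to a basis picked by \<open>SOME\<close>; all bases of
  \<open>S\<close> are equipotent, so any explicit one computes it.\<close>

lemma cdim_ordIso:
  assumes "independent B" "span B = S"
  shows "cdim scale S =o |B|"
proof -
  let ?P = "\<lambda>B. B \<subseteq> S \<and> independent B \<and> span B = S"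
  have "?P B"
    using assms span_superset by blast
  then have "?P (SOME B. ?P B)"
    by (rule someI)
  then show ?thesis
    unfolding cdim_def using assms by (intro ordIso_of_bases) auto
qed

text \<open>A basis of \<open>X\<close> extended to one of \<open>Y\<close> cannot grow, by
  counting. The set \<open>F\<close> makes these bases finite.\<close>

lemma subspace_eq_of_dim_le:
  assumes "subspace X" "subspace Y" "X \<subseteq> Y" "Y \<subseteq> span F" "finite F" "dim Y \<le> dim X"
  shows "X = Y"
proof -
  obtain B where B: "B \<subseteq> X" "independent B" "span B = X"
    using basis_of_subspace[OF assms(1)] .
  obtain C where C: "B \<subseteq> C" "C \<subseteq> Y" "independent C" "Y \<subseteq> span C"
    using maximal_independent_subset_extend[of B Y] B assms(3) by blast
  have "finite C"
    using independent_span_bound[OF assms(5) C(3)] C(2) assms(4) by blast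
  moreover have "card C \<le> card B"
    using basis_card_eq_dim[OF C(2,4,3)] basis_card_eq_dim[of B X] B assms(6) by simp
  ultimately have "B = C"
    using C(1) card_seteq by blast
  then show ?thesis
    using B C assms by blast
qed

text \<open>
  Choose \<open>\<alpha>\<close> with \<open>dim (S \<inter> W \<alpha>)\<close> minimal among the indices for which \<open>x + S\<close> meets \<open>W \<alpha>\<close>;
  every \<open>s \<in> S\<close> with \<open>x + s \<in> W \<alpha>\<close> will do.
\<close>

lemma exists_proper_representative:
  fixes W :: "'i::linorder \<Rightarrow> 'b set"
  assumes S: "subspace S" "S \<subseteq> span F" "finite F"
    and W: "\<And>\<alpha>. subspace (W \<alpha>)" "\<And>\<alpha> \<beta>. \<alpha> \<le> \<beta> \<Longrightarrow> W \<beta> \<subseteq> W \<alpha>"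
  obtains s where "s \<in> S" "\<And>\<alpha> t. t \<in> S \<Longrightarrow> x + t \<in> W \<alpha> \<Longrightarrow> x + s \<in> W \<alpha>"
proof (cases "\<exists>\<alpha>. \<exists>t\<in>S. x + t \<in> W \<alpha>")
  case False
  then show thesis
    using that[of 0] subspace_0[OF S(1)] by blast
next
  case True
  define P where "P \<alpha> \<longleftrightarrow> (\<exists>t\<in>S. x + t \<in> W \<alpha>)" for \<alpha>
  obtain \<alpha>\<^sub>0 where \<alpha>\<^sub>0: "P \<alpha>\<^sub>0" "\<And>\<alpha>. P \<alpha> \<Longrightarrow> dim (S \<inter> W \<alpha>\<^sub>0) \<le> dim (S \<inter> W \<alpha>)"
    using True ex_has_least_nat[of P _ "\<lambda>\<alpha>. dim (S \<inter> W \<alpha>)"]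
    unfolding P_def by blast
  obtain s where s: "s \<in> S" "x + s \<in> W \<alpha>\<^sub>0"
    using \<alpha>\<^sub>0(1) P_def by blast
  show thesis
  proof (rule that[OF s(1)])
    fix \<alpha> t
    assume t: "t \<in> S" "x + t \<in> W \<alpha>"
    show "x + s \<in> W \<alpha>"
    proof (cases "\<alpha> \<le> \<alpha>\<^sub>0")
      case True
      then show ?thesis
        using s W(2) by blast
    next
      case False
      then have W\<alpha>: "W \<alpha> \<subseteq> W \<alpha>\<^sub>0"
        by (intro W(2)) simp
      then have sub: "S \<inter> W \<alpha> \<subseteq> S \<inter> W \<alpha>\<^sub>0"
        by blast
      have "P \<alpha>"
        using t P_def by blast
      then have eq: "S \<inter> W \<alpha> = S \<inter> W \<alpha>\<^sub>0"
        using S W(1) sub \<alpha>\<^sub>0(2)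
        by (intro subspace_eq_of_dim_le[of _ _ F]) (auto intro: subspace_inter)
      have "x + t \<in> W \<alpha>\<^sub>0"
        using t W\<alpha> by blast
      \<comment> \<open>This difference also lies in \<open>S\<close>, and by minimality
        \<open>S\<close> meets \<open>W \<alpha>\<^sub>0\<close> and \<open>W \<alpha>\<close> in
        the same subspace.\<close>
      then have "(x + s) - (x + t) \<in> W \<alpha>\<^sub>0"
        using s(2) W(1) subspace_diff by blast
      moreover have "s - t \<in> S"
        using s t S(1) subspace_diff by blast
      ultimately have "s - t \<in> W \<alpha>"
        using eq by auto
      then have "(x + t) + (s - t) \<in> W \<alpha>"
        using t(2) W(1) subspace_add by blast
      then show ?thesis by simp
    qed
  qed
qed

text \<open>Extend a basis of \<open>W\<close> to one of the whole space, kill the former and fix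
  the other basis vectors. This projection models the quotient map by \<open>W\<close>.\<close>

lemma exists_linear_with_kernel:
  assumes "subspace W"
  obtains p where "Vector_Spaces.linear scale scale p" "\<And>x. p x = 0 \<longleftrightarrow> x \<in> W"
proof -
  interpret vector_space_pair scale scale
    by unfold_locales
  obtain B where B: "B \<subseteq> W" "independent B" "span B = W"
    using basis_of_subspace[OF assms] .
  obtain C where C: "B \<subseteq> C" "independent C" "UNIV \<subseteq> span C"
    by (rule maximal_independent_subset_extend[of B UNIV]) (use B in auto)
  define p where "p = construct C (\<lambda>c. if c \<in> B then 0 else c)"
  have lin: "Vector_Spaces.linear scale scale p"
    unfolding p_def using C(2) by (rule linear_construct)
  interpret p: Vector_Spaces.linear scale scale p by (rule lin)
  have pC: "p c = (if c \<in> B then 0 else c)" if "c \<in> C" for c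
    unfolding p_def using construct_basis[OF C(2) that] .
  have W0: "p x = 0" if "x \<in> W" for x
    by (rule p.eq_0_on_span[of B]) (use pC C(1) B(3) that in auto)
  have id: "p y = y" if "y \<in> span (C - B)" for y
  proof -
    have "p y = id y"
      using pC by (intro linear_eq_on[OF lin linear_id that]) auto
    then show ?thesis by simp
  qed
  have "x \<in> W" if "p x = 0" for x
  proof -
    have "x \<in> span (B \<union> (C - B))"
      using C by (metis Un_Diff_cancel UNIV_I subsetD sup.absorb_iff2)
    then obtain b y where "x = b + y" "b \<in> W" "y \<in> span (C - B)"
      unfolding span_Un B(3) by blast
    then show ?thesis
      using that W0 id p.add by auto
  qed
  then show thesis
    using that lin W0 by blast
qed

end

section \<open>Bases of quotient spaces\<close>

text \<open>
  The subquotient \<open>(M + W)/W\<close> is identified with the image of \<open>M\<close> under any linear map that has kernel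
  \<open>W\<close> on \<open>M\<close>, so that its coset bases can be compared with bases in the ordinary sense.
\<close>

context vector_space
begin

lemma mem_coset_iff: "y \<in> coset W x \<longleftrightarrow> y - x \<in> W"
  unfolding coset_def by (auto simp: algebra_simps intro!: exI[of _ "y - x"])

lemma coset_eq_iff:
  assumes "subspace W"
  shows "coset W x = coset W y \<longleftrightarrow> x - y \<in> W"
proof
  assume "coset W x = coset W y"
  moreover have "x \<in> coset W x"
    by (simp add: mem_coset_iff subspace_0[OF assms])
  ultimately show "x - y \<in> W"
    by (simp add: mem_coset_iff)
next
  assume *: "x - y \<in> W"
  have "z - x \<in> W \<longleftrightarrow> z - y \<in> W" for z
    using subspace_add[OF assms _ *, of "z - x"] subspace_diff[OF assms _ *, of "z - y"]
    by (auto simp: algebra_simps)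
  then show "coset W x = coset W y"
    by (auto simp: mem_coset_iff)
qed

lemma coset_zero: "coset W 0 = W"
  by (auto simp: coset_def)

text \<open>A change of representatives alters the sum only by an element of \<open>W\<close>, so
  combinations of cosets can be computed on any representatives.\<close>

lemma coset_comb_eq:
  assumes "subspace W" "finite S" "\<And>C. C \<in> S \<Longrightarrow> C = coset W (r C)"
  shows "coset_comb scale W S c = coset W (\<Sum>C\<in>S. scale (c C) (r C))"
proof (intro equalityI subsetI)
  fix y
  assume "y \<in> coset_comb scale W S c"
  then obtain r' w where y: "y = (\<Sum>C\<in>S. scale (c C) (r' C)) + w" "w \<in> W"
    and r': "\<And>C. C \<in> S \<Longrightarrow> r' C \<in> C"
    unfolding coset_comb_def by blast
  have "r' C - r C \<in> W" if "C \<in> S" for C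
    using r'[OF that] assms(3)[OF that] mem_coset_iff by metis
  then have "(\<Sum>C\<in>S. scale (c C) (r' C - r C)) + w \<in> W"
    using y(2) by (intro subspace_add subspace_sum subspace_scale assms(1))
  then show "y \<in> coset W (\<Sum>C\<in>S. scale (c C) (r C))"
    unfolding y mem_coset_iff by (simp add: scale_right_diff_distrib sum_subtractf algebra_simps)
next
  fix y
  assume "y \<in> coset W (\<Sum>C\<in>S. scale (c C) (r C))"
  then obtain w where "y = (\<Sum>C\<in>S. scale (c C) (r C)) + w" "w \<in> W"
    unfolding coset_def by blast
  moreover have "\<forall>C\<in>S. r C \<in> C"
    using assms(3) mem_coset_iff subspace_0[OF assms(1)] by (metis diff_self)
  ultimately show "y \<in> coset_comb scale W S c"
    unfolding coset_comb_def by blast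
qed

end

section \<open>Coset bases versus ordinary bases\<close>

context vector_space_pair
begin

context
  fixes M W p
  assumes M: "vs1.subspace M" and W: "vs1.subspace W"
    and p: "Vector_Spaces.linear s1 s2 p" and ker: "\<And>x. x \<in> M \<Longrightarrow> p x = 0 \<longleftrightarrow> x \<in> W"
begin

interpretation p: Vector_Spaces.linear s1 s2 p by (rule p)

lemma coset_eq_iff_image_eq:
  assumes "x \<in> M" "y \<in> M"
  shows "coset W x = coset W y \<longleftrightarrow> p x = p y"
  using ker[of "x - y"] assms vs1.subspace_diff[OF M, of x y]
  by (simp add: vs1.coset_eq_iff[OF W] p.diff)

lemma coset_comb_eq_coset_iff:
  assumes "finite S" "\<And>C. C \<in> S \<Longrightarrow> r C \<in> M \<and> C = coset W (r C)" "x \<in> M"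
  shows "coset_comb s1 W S c = coset W x \<longleftrightarrow> (\<Sum>C\<in>S. s2 (c C) (p (r C))) = p x"
proof -
  have "(\<Sum>C\<in>S. s1 (c C) (r C)) \<in> M"
    using assms(2) by (intro vs1.subspace_sum vs1.subspace_scale M) auto
  then show ?thesis
    using assms coset_eq_iff_image_eq[OF _ assms(3)]
    by (simp add: vs1.coset_comb_eq[OF W assms(1), of r] p.sum p.scale)
qed

text \<open>Choose a representative \<open>r C\<close> of each basis coset and apply
  \<open>p\<close>: by \<open>coset_comb_eq_coset_iff\<close>, independence and generation carry
  over to the vectors \<open>p (r C)\<close>.\<close>

lemma ordIso_coset_basis:
  assumes \<B>: "coset_basis s1 W (coset W ` M) \<B>"
  obtains B where "vs2.independent B" "vs2.span B = p ` M" "|\<B>| =o |B|"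
proof -
  define r where "r C = (SOME m. m \<in> M \<and> C = coset W m)" for C
  have r: "r C \<in> M \<and> C = coset W (r C)" if "C \<in> \<B>" for C
    unfolding r_def by (rule someI_ex) (use that \<B> in \<open>auto simp: coset_basis_def\<close>)
  have inj: "inj_on (\<lambda>C. p (r C)) \<B>"
  proof (rule inj_onI)
    fix C D
    assume *: "C \<in> \<B>" "D \<in> \<B>" "p (r C) = p (r D)"
    have "coset W (r C) = coset W (r D)"
      using coset_eq_iff_image_eq[of "r C" "r D"] r *(1,2) *(3) by blast
    then show "C = D"
      using r *(1,2) by metis
  qed
  define B where "B = (\<lambda>C. p (r C)) ` \<B>"
  have card: "|\<B>| =o |B|"
    using inj card_of_ordIsoI unfolding B_def bij_betw_def by blast
  have BM: "B \<subseteq> p ` M"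
    using r by (auto simp: B_def)
  have "vs2.independent B"
    unfolding vs2.independent_explicit_module
  proof (intro allI impI)
    fix t c b
    assume t: "finite t" "t \<subseteq> B" "(\<Sum>b\<in>t. s2 (c b) b) = 0" "b \<in> t"
    obtain S where S: "S \<subseteq> \<B>" "t = (\<lambda>C. p (r C)) ` S"
      using t(2) unfolding B_def by (meson subset_image_iff)
    have injS: "inj_on (\<lambda>C. p (r C)) S"
      using inj S(1) by (rule inj_on_subset)
    have fin: "finite S"
      using t(1) S(2) injS finite_image_iff by blast
    have "(\<Sum>C\<in>S. s2 (c (p (r C))) (p (r C))) = p 0"
      using t(3) unfolding S(2) sum.reindex[OF injS] by (simp add: o_def p.zero)
    then have "coset_comb s1 W S (\<lambda>C. c (p (r C))) = W"
      using coset_comb_eq_coset_iff[OF fin, of r 0] r S(1) vs1.subspace_0[OF M]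
      by (auto simp: vs1.coset_zero)
    then have "\<forall>C\<in>S. c (p (r C)) = 0"
      using \<B> fin S(1) unfolding coset_basis_def by blast
    then show "c b = 0"
      using t(4) S(2) by auto
  qed
  moreover have "p ` M \<subseteq> vs2.span B"
  proof safe
    fix m
    assume m: "m \<in> M"
    then have "coset W m \<in> coset W ` M"
      by blast
    then obtain S c where S: "finite S" "S \<subseteq> \<B>" "coset W m = coset_comb s1 W S c"
      using \<B> unfolding coset_basis_def by meson
    then have "p m = (\<Sum>C\<in>S. s2 (c C) (p (r C)))"
      using coset_comb_eq_coset_iff[OF S(1) _ m, of r c] r S(2) by (metis subsetD)
    also have "\<dots> \<in> vs2.span B"
      using S(2) by (intro vs2.span_sum vs2.span_scale vs2.span_base) (auto simp: B_def)
    finally show "p m \<in> vs2.span B" .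
  qed
  then have "vs2.span B = p ` M"
    using BM vs2.span_subspace p.subspace_image[OF M] by blast
  ultimately show thesis
    using that card by blast
qed

text \<open>Conversely, a basis of the image of \<open>M\<close> under \<open>p\<close> is lifted to
  \<open>M\<close>, and the cosets of the lifts form a coset basis.\<close>

lemma exists_coset_basis: "\<exists>\<B>. coset_basis s1 W (coset W ` M) \<B>"
proof -
  obtain B where B: "B \<subseteq> p ` M" "vs2.independent B" "vs2.span B = p ` M"
    using vs2.basis_of_subspace[OF p.subspace_image[OF M]] .
  define r where "r b = (SOME m. m \<in> M \<and> p m = b)" for b
  have r: "r b \<in> M \<and> p (r b) = b" if "b \<in> B" for b
    unfolding r_def by (rule someI_ex) (use that B(1) in auto)
  define \<B> where "\<B> = (\<lambda>b. coset W (r b)) ` B"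
  \<comment> \<open>Representatives are taken among the chosen lifts \<open>r b\<close>, so that
    \<open>p (q C)\<close> is one of the given basis vectors.\<close>
  define q where "q C = r (SOME b. b \<in> B \<and> C = coset W (r b))" for C
  have q: "q C \<in> M \<and> C = coset W (q C) \<and> p (q C) \<in> B" if "C \<in> \<B>" for C
  proof -
    have "\<exists>b. b \<in> B \<and> C = coset W (r b)"
      using that unfolding \<B>_def by blast
    then have "(SOME b. b \<in> B \<and> C = coset W (r b)) \<in> B \<and>
        C = coset W (r (SOME b. b \<in> B \<and> C = coset W (r b)))"
      by (rule someI_ex)
    then show ?thesis
      unfolding q_def using r by metis
  qed
  have inj: "inj_on (\<lambda>C. p (q C)) \<B>"
  proof (rule inj_onI)
    fix C D
    assume *: "C \<in> \<B>" "D \<in> \<B>" "p (q C) = p (q D)"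
    have "coset W (q C) = coset W (q D)"
      using coset_eq_iff_image_eq[of "q C" "q D"] q *(1,2) *(3) by blast
    then show "C = D"
      using q *(1,2) by metis
  qed
  have image: "(\<lambda>C. p (q C)) ` \<B> = B"
  proof (intro equalityI subsetI)
    fix b
    assume b: "b \<in> B"
    then have C: "coset W (r b) \<in> \<B>"
      unfolding \<B>_def by blast
    then have "p (q (coset W (r b))) = p (r b)"
      using q[OF C] r[OF b] coset_eq_iff_image_eq[of "q (coset W (r b))" "r b"] by simp
    then show "b \<in> (\<lambda>C. p (q C)) ` \<B>"
      using C r[OF b] by (metis imageI)
  qed (use q in auto)
  have "coset_basis s1 W (coset W ` M) \<B>"
    unfolding coset_basis_def
  proof (intro conjI allI impI ballI)
    show "\<B> \<subseteq> coset W ` M"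
      using r by (auto simp: \<B>_def)
  next
    fix S c C
    assume *: "finite S \<and> S \<subseteq> \<B> \<and> coset_comb s1 W S c = W" and C: "C \<in> S"
    have injS: "inj_on (\<lambda>C. p (q C)) S"
      using inj * inj_on_subset by blast
    have "(\<Sum>C\<in>S. s2 (c C) (p (q C))) = p 0"
      using coset_comb_eq_coset_iff[of S q 0 c] q * vs1.subspace_0[OF M]
      by (auto simp: vs1.coset_zero)
    \<comment> \<open>Coefficients are reindexed by basis vectors through the inverse of the
      injection, which is the form that \<open>independentD\<close> expects.\<close>
    then have "(\<Sum>b\<in>(\<lambda>C. p (q C)) ` S. s2 (c (the_inv_into S (\<lambda>C. p (q C)) b)) b) = 0"
      unfolding sum.reindex[OF injS] by (simp add: the_inv_into_f_f[OF injS] p.zero)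
    then have "c (the_inv_into S (\<lambda>C. p (q C)) (p (q C))) = 0"
      using * C image by (intro vs2.independentD[OF B(2)]) auto
    then show "c C = 0"
      using the_inv_into_f_f[OF injS C] by simp
  next
    fix C
    assume "C \<in> coset W ` M"
    then obtain m where m: "m \<in> M" "C = coset W m"
      by blast
    then have "p m \<in> vs2.span ((\<lambda>C. p (q C)) ` \<B>)"
      using B(3) image by blast
    then obtain t c where t: "finite t" "t \<subseteq> (\<lambda>C. p (q C)) ` \<B>" "p m = (\<Sum>b\<in>t. s2 (c b) b)"
      unfolding vs2.span_explicit by blast
    obtain S where S: "S \<subseteq> \<B>" "t = (\<lambda>C. p (q C)) ` S"
      using t(2) by (meson subset_image_iff)
    have injS: "inj_on (\<lambda>C. p (q C)) S"
      using inj S(1) by (rule inj_on_subset)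
    have fin: "finite S"
      using t(1) S(2) injS finite_image_iff by blast
    have "(\<Sum>C\<in>S. s2 (c (p (q C))) (p (q C))) = p m"
      unfolding t(3) S(2) sum.reindex[OF injS] by simp
    then have "coset_comb s1 W S (\<lambda>C. c (p (q C))) = C"
      using coset_comb_eq_coset_iff[OF fin _ m(1), of q] q S(1) m(2) by auto
    then show "\<exists>S c. finite S \<and> S \<subseteq> \<B> \<and> C = coset_comb s1 W S c"
      using fin S(1) by blast
  qed
  then show ?thesis ..
qed

text \<open>The choice hidden in \<open>coset_cdim\<close> is harmless: every coset basis is
  equipotent to a basis of the image of \<open>M\<close>. As \<open>p\<close> may lead into another
  space, invariants of two representations can be measured in one space.\<close>

lemma coset_cdim_ordIso:
  assumes "vs2.independent B" "vs2.span B = p ` M"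
  shows "coset_cdim s1 W (coset W ` M) =o |B|"
proof -
  have "coset_basis s1 W (coset W ` M) (SOME \<B>. coset_basis s1 W (coset W ` M) \<B>)"
    using exists_coset_basis by (rule someI_ex)
  then obtain B' where B': "vs2.independent B'" "vs2.span B' = p ` M"
    "coset_cdim s1 W (coset W ` M) =o |B'|"
    unfolding coset_cdim_def by (rule ordIso_coset_basis)
  have "|B'| =o |B|"
    using assms B' by (intro vs2.ordIso_of_bases) auto
  with B'(3) show ?thesis
    by (rule ordIso_transitive)
qed

end

end

section \<open>Linear relations\<close>

definition linear_relation ::
    "('f \<Rightarrow> 'a \<Rightarrow> 'a) \<Rightarrow> ('f \<Rightarrow> 'b \<Rightarrow> 'b) \<Rightarrow> ('a::ab_group_add \<times> 'b::ab_group_add) set \<Rightarrow> bool"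
  where "linear_relation s1 s2 R \<longleftrightarrow> (0, 0) \<in> R \<and>
    (\<forall>x y x' y'. (x, y) \<in> R \<longrightarrow> (x', y') \<in> R \<longrightarrow> (x + x', y + y') \<in> R) \<and>
    (\<forall>c x y. (x, y) \<in> R \<longrightarrow> (s1 c x, s2 c y) \<in> R)"

lemma linear_relation_zero: "linear_relation s1 s2 R \<Longrightarrow> (0, 0) \<in> R"
  and linear_relation_add:
    "linear_relation s1 s2 R \<Longrightarrow> (x, y) \<in> R \<Longrightarrow> (x', y') \<in> R \<Longrightarrow> (x + x', y + y') \<in> R"
  and linear_relation_scale:
    "linear_relation s1 s2 R \<Longrightarrow> (x, y) \<in> R \<Longrightarrow> (s1 c x, s2 c y) \<in> R"
  unfolding linear_relation_def by blast+

lemma linear_relation_converse: "linear_relation s2 s1 (R\<inverse>) \<longleftrightarrow> linear_relation s1 s2 R"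
  unfolding linear_relation_def by auto

context vector_space_pair
begin

lemma linear_relation_diff:
  assumes "linear_relation s1 s2 R" "(x, y) \<in> R" "(x', y') \<in> R"
  shows "(x - x', y - y') \<in> R"
  using linear_relation_add[OF assms(1,2) linear_relation_scale[OF assms(1,3), of "- 1"]]
  by (simp add: vs1.scale_minus_left vs2.scale_minus_left)

lemma subspace_Domain: "linear_relation s1 s2 R \<Longrightarrow> vs1.subspace (Domain R)"
  unfolding vs1.subspace_def
  by (auto intro: linear_relation_zero dest: linear_relation_add linear_relation_scale)

lemma linear_relation_sum:
  assumes "linear_relation s1 s2 R" "\<And>i. i \<in> I \<Longrightarrow> (f i, g i) \<in> R"
  shows "(\<Sum>i\<in>I. s1 (c i) (f i), \<Sum>i\<in>I. s2 (c i) (g i)) \<in> R"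
  using assms(2)
  by (induction I rule: infinite_finite_induct)
    (auto intro!: linear_relation_zero[OF assms(1)] linear_relation_add[OF assms(1)]
      linear_relation_scale[OF assms(1)])

text \<open>
  If \<open>M\<^sub>1/W\<^sub>1\<close> and \<open>M\<^sub>2/W\<^sub>2\<close> have equal dimensions and \<open>H\<close> induces an isomorphism from a finite
  dimensional proper subspace of the first quotient, then the image is not all of the second.
\<close>

lemma exists_outside_Range:
  assumes lin: "Vector_Spaces.linear s1 s1 p1" "Vector_Spaces.linear s2 s2 p2"
    and ker: "\<And>x. p1 x = 0 \<longleftrightarrow> x \<in> W1" "\<And>y. p2 y = 0 \<longleftrightarrow> y \<in> W2"
    and B1: "vs1.span B1 = p1 ` M1"
    and B2: "vs2.independent B2" "vs2.span B2 = p2 ` M2"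
    and card: "|B1| =o |B2|"
    and H: "linear_relation s1 s2 H" "Domain H \<subseteq> vs1.span F" "finite F"
    and HW: "\<And>s t. (s, t) \<in> H \<Longrightarrow> s \<in> W1 \<longleftrightarrow> t \<in> W2"
    and HM: "p1 ` Domain H \<subseteq> p1 ` M1"
    and m: "m \<in> M1" "p1 m \<notin> p1 ` Domain H"
  obtains m' where "m' \<in> M2" "p2 m' \<notin> p2 ` Range H"
proof (rule ccontr)
  interpret p1: Vector_Spaces.linear s1 s1 p1 by (rule lin)
  interpret p2: Vector_Spaces.linear s2 s2 p2 by (rule lin)
  assume "\<not> thesis"
  then have sub: "p2 ` M2 \<subseteq> p2 ` Range H"
    using that by blast
  obtain C where C: "C \<subseteq> p1 ` Domain H" "vs1.independent C" "vs1.span C = p1 ` Domain H"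
    using vs1.basis_of_subspace[OF p1.subspace_image[OF subspace_Domain[OF H(1)]]] .
  have "C \<subseteq> vs1.span (p1 ` F)"
    using C(1) H(2) p1.span_image[of F] by blast
  then have finC: "finite C"
    using vs1.independent_span_bound[of "p1 ` F" C] C(2) H(3) by blast
  have "\<forall>c\<in>C. \<exists>s t. (s, t) \<in> H \<and> p1 s = c"
    using C(1) by blast
  then obtain s t where st: "\<And>c. c \<in> C \<Longrightarrow> (s c, t c) \<in> H \<and> p1 (s c) = c"
    by metis
  have "p2 ` Range H \<subseteq> vs2.span ((\<lambda>c. p2 (t c)) ` C)"
  proof clarify
    fix x y
    assume xy: "(x, y) \<in> H"
    then have "p1 x \<in> vs1.span C"
      using C(3) by blast
    then obtain a where a: "p1 x = (\<Sum>c\<in>C. s1 (a c) c)"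
      unfolding vs1.span_finite[OF finC] by blast
    \<comment> \<open>Subtracting a combination of the pairs over \<open>C\<close> makes the first
      component vanish modulo \<open>W1\<close>; by \<open>HW\<close> the second then vanishes
      modulo \<open>W2\<close>.\<close>
    have "(x - (\<Sum>c\<in>C. s1 (a c) (s c)), y - (\<Sum>c\<in>C. s2 (a c) (t c))) \<in> H"
      using st by (intro linear_relation_diff[OF H(1) xy] linear_relation_sum[OF H(1)]) blast
    moreover have "p1 (x - (\<Sum>c\<in>C. s1 (a c) (s c))) = 0"
      using st by (simp add: p1.diff p1.sum p1.scale a)
    ultimately have "p2 (y - (\<Sum>c\<in>C. s2 (a c) (t c))) = 0"
      using HW ker by blast
    then have "p2 y = (\<Sum>c\<in>C. s2 (a c) (p2 (t c)))"
      by (simp add: p2.diff p2.sum p2.scale)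
    also have "\<dots> \<in> vs2.span ((\<lambda>c. p2 (t c)) ` C)"
      by (intro vs2.span_sum vs2.span_scale vs2.span_base) auto
    finally show "p2 y \<in> vs2.span ((\<lambda>c. p2 (t c)) ` C)" .
  qed
  then have "B2 \<subseteq> vs2.span ((\<lambda>c. p2 (t c)) ` C)"
    using sub B2(2) vs2.span_superset[of B2] by simp
  then have fin2: "finite B2" "card B2 \<le> card ((\<lambda>c. p2 (t c)) ` C)"
    using vs2.independent_span_bound[OF finite_imageI[OF finC] B2(1)] by simp_all
  then have "card B2 \<le> card C"
    using card_image_le[OF finC, of "\<lambda>c. p2 (t c)"] by linarith
  moreover obtain f where f: "bij_betw f B1 B2"
    using card card_of_ordIso by blast
  ultimately have B1C: "finite B1" "card B1 \<le> card C"
    using bij_betw_finite[OF f] bij_betw_same_card[OF f] fin2 by auto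
  \<comment> \<open>\<open>p1 m\<close> enlarges \<open>C\<close> to an independent set with one
    more element in the span of \<open>B1\<close>, against
    \<open>card B1 \<le> card C\<close>.\<close>
  have "vs1.independent (insert (p1 m) C)"
    using C(2,3) m(2) by (intro vs1.independent_insertI) auto
  moreover have "insert (p1 m) C \<subseteq> vs1.span B1"
    using B1 m(1) C(1) HM by blast
  ultimately have "card (insert (p1 m) C) \<le> card B1"
    using vs1.independent_span_bound[OF B1C(1)] by blast
  moreover have "p1 m \<notin> C"
    using C(1) m(2) by blast
  ultimately show False
    using B1C(2) finC by simp
qed

end

section \<open>Filtrations of cyclic representations\<close>

text \<open>If \<alpha> were the largest element, the whole type would be a countable initial
  segment plus one point. Otherwise the least larger element is the successor.\<close>

lemma omega1_successor:
  fixes \<alpha> :: omega1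
  obtains \<gamma> where "{..<\<gamma>} = {..\<alpha>}"
proof -
  have "\<exists>\<gamma>. \<alpha> < \<gamma>"
  proof (rule ccontr)
    assume "\<nexists>\<gamma>. \<alpha> < \<gamma>"
    then have "UNIV = insert \<alpha> {..<\<alpha>}"
      by (metis UNIV_eq_I insertCI lessThan_iff not_less_iff_gr_or_eq)
    then show False
      using uncountable_omega1 countable_lessThan_omega1[of \<alpha>] by (metis countable_insert)
  qed
  then have "\<alpha> < (LEAST \<gamma>. \<alpha> < \<gamma>)"
    by (rule LeastI_ex)
  then have "{..<(LEAST \<gamma>. \<alpha> < \<gamma>)} = {..\<alpha>}"
    by (auto dest: not_less_Least)
  then show thesis
    by (rule that)
qed

section \<open>Vectors picked along a descending chain of subspaces\<close>

context vector_space
begin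

text \<open>In a nontrivial vanishing combination, the term of least index \<open>i\<close> with
  nonzero coefficient is a combination of later vectors. These lie in \<open>W i\<close>, but
  \<open>x i\<close> does not.\<close>

lemma independent_of_descending:
  fixes x :: "'i::linorder \<Rightarrow> 'b"
  assumes W: "\<And>i. subspace (W i)" and x: "\<And>i. i \<in> I \<Longrightarrow> x i \<notin> W i"
    and lt: "\<And>i j. i \<in> I \<Longrightarrow> j \<in> I \<Longrightarrow> i < j \<Longrightarrow> x j \<in> W i"
    and inj: "inj_on x I"
  shows "independent (x ` I)"
proof -
  have "c v = 0" if t: "finite t" "t \<subseteq> x ` I" "(\<Sum>v\<in>t. scale (c v) v) = 0" "v \<in> t" for t c v
  proof (rule ccontr)
    assume cv: "c v \<noteq> 0"
    obtain J where J: "J \<subseteq> I" "t = x ` J"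
      using t(2) by (meson subset_image_iff)
    have injJ: "inj_on x J"
      using inj J(1) by (rule inj_on_subset)
    have finJ: "finite J"
      using t(1) J(2) injJ finite_image_iff by blast
    define J' where "J' = {j \<in> J. c (x j) \<noteq> 0}"
    have J': "finite J'" "J' \<noteq> {}"
      using finJ t(4) J(2) cv by (auto simp: J'_def)
    define i where "i = Min J'"
    have i: "i \<in> J'" "\<And>j. j \<in> J' \<Longrightarrow> i \<le> j"
      using J' by (auto simp: i_def)
    have iI: "i \<in> I" "i \<in> J" "c (x i) \<noteq> 0"
      using i(1) J(1) by (auto simp: J'_def)
    have "0 = (\<Sum>j\<in>J. scale (c (x j)) (x j))"
      using t(3) unfolding J(2) sum.reindex[OF injJ] by simp
    also have "\<dots> = scale (c (x i)) (x i) + (\<Sum>j\<in>J - {i}. scale (c (x j)) (x j))"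
      using finJ iI(2) by (rule sum.remove)
    finally have "scale (c (x i)) (x i) = - (\<Sum>j\<in>J - {i}. scale (c (x j)) (x j))"
      by (metis add_eq_0_iff2)
    moreover have "scale (c (x j)) (x j) \<in> W i" if "j \<in> J - {i}" for j
    proof (cases "c (x j) = 0")
      case True
      then show ?thesis
        using subspace_0[OF W] by simp
    next
      case False
      then have "i < j"
        using that i(2)[of j] by (auto simp: J'_def)
      then show ?thesis
        using lt[OF iI(1)] that J(1) by (intro subspace_scale W) auto
    qed
    ultimately have "scale (c (x i)) (x i) \<in> W i"
      by (simp only:) (intro subspace_neg subspace_sum W)
    then have "scale (inverse (c (x i))) (scale (c (x i)) (x i)) \<in> W i"
      by (rule subspace_scale[OF W])
    then show False
      using x[OF iI(1)] iI(3) by simp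
  qed
  then show ?thesis
    unfolding independent_explicit_module by blast
qed

end

section \<open>The filtration, its stable part and the invariants\<close>

context cyclic_rep
begin

lemma next_less: "(k + 1) mod n < n"
  using n_pos by simp

lemma mod_pred_next: "k < n \<Longrightarrow> ((k + 1) mod n + n - 1) mod n = k"
  by (cases "k + 1 = n") auto

lemma mod_next_pred: "k < n \<Longrightarrow> ((k + n - 1) mod n + 1) mod n = k"
  using n_pos by (simp add: mod_Suc_eq)

lemma shift_next: "k < n \<Longrightarrow> shift W ((k + 1) mod n) = u k ` W k"
  unfolding shift_def by (simp only: mod_pred_next)

text \<open>Every vertex is the successor of some vertex, so claims about \<open>shift\<close> may
  be proved at \<open>(k + 1) mod n\<close>, where \<open>shift_next\<close> applies.\<close>

lemma all_next:
  assumes "\<And>k. k < n \<Longrightarrow> P ((k + 1) mod n)" "k < n"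
  shows "P k"
  using assms(1)[of "(k + n - 1) mod n"] mod_next_pred[OF assms(2)] n_pos by simp

lemma u_in: "k < n \<Longrightarrow> x \<in> U k \<Longrightarrow> u k x \<in> U ((k + 1) mod n)"
  and u_add: "k < n \<Longrightarrow> x \<in> U k \<Longrightarrow> y \<in> U k \<Longrightarrow> u k (x + y) = u k x + u k y"
  and u_scale: "k < n \<Longrightarrow> x \<in> U k \<Longrightarrow> u k (scale c x) = scale c (u k x)"
  using linear_u[of k] unfolding linear_map_on_def by blast+

lemma u_zero: "k < n \<Longrightarrow> u k 0 = 0"
  using u_scale[of k 0 0] subspace_0[OF subspace_U] by simp

lemma u_diff: "k < n \<Longrightarrow> x \<in> U k \<Longrightarrow> y \<in> U k \<Longrightarrow> u k (x - y) = u k x - u k y"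
  using u_add[of k "x - y" y] subspace_diff[OF subspace_U, of k x y] by simp

lemma subspace_u_image:
  assumes "k < n" "subspace W" "W \<subseteq> U k"
  shows "subspace (u k ` W)"
proof (rule subspaceI)
  show "0 \<in> u k ` W"
    using u_zero[OF assms(1)] subspace_0[OF assms(2)] by (metis imageI)
next
  fix x y
  assume "x \<in> u k ` W" "y \<in> u k ` W"
  then obtain x' y' where "x = u k x'" "y = u k y'" "x' \<in> W" "y' \<in> W"
    by blast
  then show "x + y \<in> u k ` W"
    using u_add[OF assms(1), of x' y'] assms(3) subspace_add[OF assms(2)]
    by (metis imageI subsetD)
next
  fix c x
  assume "x \<in> u k ` W"
  then obtain x' where "x = u k x'" "x' \<in> W"
    by blast
  then show "scale c x \<in> u k ` W"
    using u_scale[OF assms(1), of x' c] assms(3) subspace_scale[OF assms(2)]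
    by (metis imageI subsetD)
qed

lemma subspace_shift:
  assumes "\<And>k. k < n \<Longrightarrow> subspace (W k)" "\<And>k. k < n \<Longrightarrow> W k \<subseteq> U k" "k < n"
  shows "subspace (shift W k)"
  using assms(3)
proof (rule all_next[rotated])
  fix k
  assume "k < n"
  then show "subspace (shift W ((k + 1) mod n))"
    using assms(1,2) by (simp only: shift_next subspace_u_image)
qed

lemma U_ord_subset: "k < n \<Longrightarrow> U_ord \<alpha> k \<subseteq> U k"
proof -
  assume k: "k < n"
  define z :: 'b where "z = (LEAST z. True)"
  have z: "z \<le> \<beta>" for \<beta>
    unfolding z_def by (simp add: Least_le)
  then have "{..<z} = {}"
    by (auto simp: not_less[symmetric])
  then show ?thesis
    using U_ord_antimono[OF z k, of \<alpha>] by (simp add: U_ord_zero)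
qed

lemma subspace_U_ord: "k < n \<Longrightarrow> subspace (U_ord \<alpha> k)"
proof (induction \<alpha> arbitrary: k rule: less_induct)
  case (less \<alpha>)
  consider "{..<\<alpha>} = {}" | \<gamma> where "{..<\<alpha>} = {..\<gamma>}"
    | "{..<\<alpha>} \<noteq> {}" "\<And>\<beta>. {..<\<alpha>} \<noteq> {..\<beta>}"
    by blast
  then show ?case
  proof cases
    case 1
    then show ?thesis
      using subspace_U less.prems by (simp add: U_ord_zero)
  next
    case (2 \<gamma>)
    then have "\<gamma> < \<alpha>" by auto
    then show ?thesis
      unfolding U_ord_succ[OF 2]
      by (intro subspace_shift less.IH U_ord_subset less.prems)
  next
    case 3
    then show ?thesis
      using less.IH less.prems unfolding U_ord_limit[OF 3]
      by (intro subspace_Int) auto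
  qed
qed

lemma subspace_shift_U_ord: "k < n \<Longrightarrow> subspace (shift (U_ord \<alpha>) k)"
  by (intro subspace_shift subspace_U_ord U_ord_subset)

lemma subspace_U_inf: "k < n \<Longrightarrow> subspace (U_inf k)"
  unfolding U_inf_def by (intro subspace_Int subspace_U_ord)

lemma U_inf_subset: "k < n \<Longrightarrow> U_inf k \<subseteq> U k"
  using U_inf_subset_U_ord U_ord_subset by blast

text \<open>With \<open>shift_U_inf\<close>, this makes \<open>U_inf\<close> the largest family
  inside \<open>U\<close> contained in its own shift, a description without ordinals that can be
  transported between representations.\<close>

lemma shift_stable_subset_U_inf:
  assumes "\<And>k. k < n \<Longrightarrow> W k \<subseteq> U k" "\<And>k. k < n \<Longrightarrow> W k \<subseteq> shift W k" "k < n"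
  shows "W k \<subseteq> U_inf k"
  unfolding U_inf_def using shift_stable_subset_U_ord[OF assms] by blast

text \<open>A stage equal to its own shift lies in \<open>U_inf\<close> by maximality. The ordinal
  may come from any type, in particular from \<open>omega1\<close>.\<close>

lemma U_inf_eq_of_stable:
  assumes "\<And>k. k < n \<Longrightarrow> shift (U_ord \<alpha>) k = U_ord \<alpha> k" "k < n"
  shows "U_inf k = U_ord \<alpha> k"
proof (rule equalityI[OF U_inf_subset_U_ord[OF assms(2)]])
  show "U_ord \<alpha> k \<subseteq> U_inf k"
    by (rule shift_stable_subset_U_inf[OF U_ord_subset _ assms(2)]) (use assms(1) in auto)
qed

lemma shift_U_inf: "k < n \<Longrightarrow> shift U_inf k = U_inf k"
proof -
  assume k: "k < n"
  obtain \<alpha> :: "(nat \<times> 'a) ord_below" where st: "\<forall>k<n. shift (U_ord \<alpha>) k = U_ord \<alpha> k"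
    using U_ord_stabilizes by blast
  then have eq: "j < n \<Longrightarrow> U_inf j = U_ord \<alpha> j" for j
    using U_inf_eq_of_stable[of \<alpha>] by blast
  then have "shift U_inf k = shift (U_ord \<alpha>) k"
    by (intro equalityI shift_mono) auto
  then show ?thesis
    using st eq k by simp
qed

lemma u_image_U_inf: "k < n \<Longrightarrow> u k ` U_inf k = U_inf ((k + 1) mod n)"
  using shift_U_inf[OF next_less, of k] by (simp only: shift_next)

lemma countable_spanning_set:
  assumes "dimension \<le>o natLeq" "k < n"
  obtains A where "countable A" "A \<subseteq> U k" "span A = U k"
proof -
  obtain A where A: "A \<subseteq> U k" "independent A" "span A = U k"
    using basis_of_subspace[OF subspace_U[OF assms(2)]] .
  obtain B where B: "cdim scale (U k) = |B|"
    unfolding cdim_def by blast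
  have "|A| =o |B|"
    using cdim_ordIso[OF A(2,3)] unfolding B by (rule ordIso_symmetric)
  also have "|B| \<le>o dimension"
  proof -
    have "Pair k ` B \<subseteq> (SIGMA j:{..<n}. Field (cdim scale (U j)))"
      using assms(2) by (auto simp: B Field_card_of)
    then have "|B| \<le>o |SIGMA j:{..<n}. Field (cdim scale (U j))|"
      by (intro iffD1[OF card_of_ordLeq] exI[of _ "Pair k"] conjI) (auto intro: inj_onI)
    then show ?thesis
      unfolding dimension_def Csum_def by (simp add: Field_card_of)
  qed
  also note assms(1)
  finally have "|A| \<le>o natLeq" .
  then have "countable A"
    by (simp add: countable_card_le_natLeq)
  then show thesis
    using that A by blast
qed

section \<open>Stabilization at a countable ordinal\<close>

lemma U_ord_subset_shift:
  fixes \<alpha> \<beta> :: omega1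
  assumes "\<alpha> < \<beta>" "k < n"
  shows "U_ord \<beta> k \<subseteq> shift (U_ord \<alpha>) k"
proof -
  obtain \<gamma> where \<gamma>: "{..<\<gamma>} = {..\<alpha>}"
    by (rule omega1_successor)
  then have "\<gamma> \<le> \<beta>"
    using assms(1) by (metis atMost_iff lessThan_iff not_le)
  then show ?thesis
    using U_ord_antimono[of \<gamma> \<beta> k] assms(2) by (simp add: U_ord_succ[OF \<gamma>])
qed

text \<open>Otherwise every \<alpha> has a vertex \<open>\<kappa> \<alpha>\<close> and a vector
  \<open>x \<alpha>\<close> lost there after stage \<alpha>. The vectors lost at one vertex are
  independent, hence countably many, and finitely many vertices cannot exhaust
  \<open>omega1\<close>.\<close>

lemma U_ord_stabilizes_omega1:
  assumes "dimension \<le>o natLeq"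
  shows "\<exists>\<alpha> :: omega1. \<forall>k<n. shift (U_ord \<alpha>) k = U_ord \<alpha> k"
proof (rule ccontr)
  assume "\<not> ?thesis"
  then have "\<forall>\<alpha> :: omega1. \<exists>k x. k < n \<and> x \<in> U_ord \<alpha> k \<and> x \<notin> shift (U_ord \<alpha>) k"
    using shift_U_ord_subset by fastforce
  then obtain \<kappa> x where \<kappa>: "\<And>\<alpha>::omega1. \<kappa> \<alpha> < n"
    and x: "\<And>\<alpha>. x \<alpha> \<in> U_ord \<alpha> (\<kappa> \<alpha>)" "\<And>\<alpha>. x \<alpha> \<notin> shift (U_ord \<alpha>) (\<kappa> \<alpha>)"
    by metis
  have "countable {\<alpha>. \<kappa> \<alpha> = k}" if k: "k < n" for k
  proof -
    have *: "x \<beta> \<in> shift (U_ord \<alpha>) k" if "\<kappa> \<alpha> = k" "\<kappa> \<beta> = k" "\<alpha> < \<beta>" for \<alpha> \<beta>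
      using U_ord_subset_shift[OF that(3) k] x(1)[of \<beta>] that(2) by auto
    have inj: "inj_on x {\<alpha>. \<kappa> \<alpha> = k}"
    proof (rule inj_onI)
      fix \<alpha> \<beta>
      assume "\<alpha> \<in> {\<alpha>. \<kappa> \<alpha> = k}" "\<beta> \<in> {\<alpha>. \<kappa> \<alpha> = k}" "x \<alpha> = x \<beta>"
      then show "\<alpha> = \<beta>"
        using *[of \<alpha> \<beta>] *[of \<beta> \<alpha>] x(2)[of \<alpha>] x(2)[of \<beta>] by (cases \<alpha> \<beta> rule: linorder_cases) auto
    qed
    obtain A where A: "countable A" "A \<subseteq> U k" "span A = U k"
      by (rule countable_spanning_set[OF assms k])
    have "independent (x ` {\<alpha>. \<kappa> \<alpha> = k})"
    proof (rule independent_of_descending[where W = "\<lambda>\<alpha>. shift (U_ord \<alpha>) k"])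
      fix \<alpha>
      assume "\<alpha> \<in> {\<alpha>. \<kappa> \<alpha> = k}"
      then show "x \<alpha> \<notin> shift (U_ord \<alpha>) k"
        using x(2)[of \<alpha>] by simp
    qed (use * inj subspace_shift_U_ord[OF k] in simp_all)
    moreover have "x ` {\<alpha>. \<kappa> \<alpha> = k} \<subseteq> span A"
      using x(1) U_ord_subset[OF k] A(3) by auto
    ultimately have "countable (x ` {\<alpha>. \<kappa> \<alpha> = k})"
      using A(1) countable_independent by blast
    then show ?thesis
      using inj by (rule countable_image_inj_on)
  qed
  then have "countable (\<Union>k\<in>{..<n}. {\<alpha>. \<kappa> \<alpha> = k})"
    by (intro countable_UN) auto
  moreover have "(\<Union>k\<in>{..<n}. {\<alpha>. \<kappa> \<alpha> = k}) = UNIV"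
    using \<kappa> by auto
  ultimately show False
    using uncountable_omega1 by simp
qed

text \<open>Countable dimension lets \<open>omega1\<close> replace the index type of
  \<open>U_inf\<close>; hence relations that preserve membership in all stages below
  \<open>omega1\<close> also preserve \<open>U_inf\<close>.\<close>

lemma U_inf_eq_omega1:
  assumes "dimension \<le>o natLeq" "k < n"
  shows "U_inf k = (\<Inter>\<alpha>::omega1. U_ord \<alpha> k)"
proof -
  obtain \<alpha> :: omega1 where "\<forall>k<n. shift (U_ord \<alpha>) k = U_ord \<alpha> k"
    using U_ord_stabilizes_omega1[OF assms(1)] by blast
  then have "U_inf k = U_ord \<alpha> k"
    using U_inf_eq_of_stable assms(2) by blast
  then show ?thesis
    using U_inf_subset_U_ord[OF assms(2), of "_ :: omega1"] by blast
qed

text \<open>If \<open>u k x = u k y\<close> with \<open>y\<close> one stage deeper, then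
  \<open>x - y\<close> is a true kernel vector in the coset of \<open>x\<close>. So
  \<open>kappa\<close> is the dimension of the kernel vectors of stage \<alpha> modulo the next
  stage.\<close>

lemma induced_kernel_U_ord:
  assumes k: "k < n"
  shows "induced_kernel (U_ord \<alpha>) k =
    coset (shift (U_ord \<alpha>) k) ` (U_ord \<alpha> k \<inter> {x. u k x = 0})"
proof -
  let ?j = "(k + 1) mod n"
  let ?W = "U_ord \<alpha>" and ?W' = "shift (U_ord \<alpha>)" and ?W'' = "shift (shift (U_ord \<alpha>))"
  have W'W: "?W' k \<subseteq> ?W k" and WU: "?W k \<subseteq> U k"
    using shift_U_ord_subset[OF k] U_ord_subset[OF k] by auto
  have W': "subspace (?W' k)"
    by (rule subspace_shift_U_ord[OF k])
  have W'': "?W'' ?j = u k ` ?W' k"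
    by (rule shift_next[OF k])
  have subW'': "subspace (?W'' ?j)"
    unfolding W'' using W' W'W WU by (intro subspace_u_image[OF k]) auto
  have ind: "induced ?W k (coset (?W' k) x) = coset (?W'' ?j) (u k x)" if x: "x \<in> ?W k" for x
  proof -
    have *: "u k (x + w) = u k x + u k w" if "w \<in> ?W' k" for w
      using x that W'W WU by (intro u_add[OF k]) auto
    have "u k x + u k w + w' \<in> coset (?W'' ?j) (u k x)" if "w \<in> ?W' k" "w' \<in> ?W'' ?j" for w w'
      using subspace_add[OF subW'' _ that(2), of "u k w"] that(1) W''
      by (simp add: mem_coset_iff add.assoc)
    moreover have "x \<in> coset (?W' k) x"
      using subspace_0[OF W'] by (simp add: mem_coset_iff)
    ultimately show ?thesis
      unfolding induced_def using * by (auto simp: coset_def) (metis add_0_right)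
  qed
  have ker: "induced ?W k (coset (?W' k) x) = ?W'' ?j \<longleftrightarrow> u k x \<in> ?W'' ?j" if "x \<in> ?W k" for x
    using coset_eq_iff[OF subW'', of "u k x" 0] ind[OF that] by (simp add: coset_zero)
  show ?thesis
  proof (intro equalityI subsetI)
    fix C
    assume "C \<in> induced_kernel ?W k"
    then obtain x where x: "x \<in> ?W k" "C = coset (?W' k) x" "u k x \<in> ?W'' ?j"
      unfolding induced_kernel_def quotient_space_def using ker by auto
    then obtain y where y: "y \<in> ?W' k" "u k x = u k y"
      unfolding W'' by blast
    have "u k (x - y) = 0"
      using u_diff[OF k, of x y] x(1) y W'W WU by auto
    moreover have "x - y \<in> ?W k"
      using x(1) y(1) W'W subspace_diff[OF subspace_U_ord[OF k]] by blast
    moreover have "C = coset (?W' k) (x - y)"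
      unfolding x(2) coset_eq_iff[OF W'] using y(1) by simp
    ultimately show "C \<in> coset (?W' k) ` (?W k \<inter> {x. u k x = 0})"
      by blast
  next
    fix C
    assume "C \<in> coset (?W' k) ` (?W k \<inter> {x. u k x = 0})"
    then obtain x where x: "x \<in> ?W k" "u k x = 0" "C = coset (?W' k) x"
      by blast
    then have "induced ?W k C = ?W'' ?j"
      using ker[OF x(1)] subspace_0[OF subW''] by simp
    then show "C \<in> induced_kernel ?W k"
      unfolding induced_kernel_def quotient_space_def using x by blast
  qed
qed

lemma subspace_kernel:
  assumes "k < n" "subspace W" "W \<subseteq> U k"
  shows "subspace (W \<inter> {x. u k x = 0})"
proof (rule subspaceI)
  show "0 \<in> W \<inter> {x. u k x = 0}"
    using subspace_0[OF assms(2)] u_zero[OF assms(1)] by simp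
next
  fix x y
  assume "x \<in> W \<inter> {x. u k x = 0}" "y \<in> W \<inter> {x. u k x = 0}"
  then show "x + y \<in> W \<inter> {x. u k x = 0}"
    using subspace_add[OF assms(2)] u_add[OF assms(1), of x y] assms(3) by auto
next
  fix c x
  assume "x \<in> W \<inter> {x. u k x = 0}"
  then show "scale c x \<in> W \<inter> {x. u k x = 0}"
    using subspace_scale[OF assms(2)] u_scale[OF assms(1), of x c] assms(3) by auto
qed

lemma kappa_ordIso:
  assumes "k < n" "Vector_Spaces.linear scale s2 p"
    and "\<And>x. x \<in> U_ord \<alpha> k \<Longrightarrow> p x = 0 \<longleftrightarrow> x \<in> shift (U_ord \<alpha>) k"
    and "\<not> module.dependent s2 B"
    and "module.span s2 B = p ` (U_ord \<alpha> k \<inter> {x. u k x = 0})"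
  shows "kappa k \<alpha> =o |B|"
proof -
  interpret p: Vector_Spaces.linear scale s2 p by (rule assms(2))
  interpret vector_space_pair scale s2 by unfold_locales
  show ?thesis
    unfolding kappa_def induced_kernel_U_ord[OF assms(1)]
    using assms
    by (intro coset_cdim_ordIso[where p = p] subspace_kernel subspace_shift_U_ord subspace_U_ord
        U_ord_subset) auto
qed

lemma kappa_inf_ordIso:
  assumes "independent B" "span B = U_inf k \<inter> {x. u k x = 0}"
  shows "kappa_inf k =o |B|"
  unfolding kappa_inf_def using assms by (rule cdim_ordIso)

section \<open>Paths along the cycle\<close>

lemma u_path_add:
  "u_path k (a + b) x = u_path ((k + a) mod n) b (u_path k a x)"
  by (induction b) (auto simp: add.assoc mod_add_left_eq)

lemma u_path_in: "k < n \<Longrightarrow> x \<in> U k \<Longrightarrow> u_path k m x \<in> U ((k + m) mod n)"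
proof (induction m)
  case (Suc m)
  then show ?case
    using u_in[of "(k + m) mod n" "u_path k m x"] n_pos by (simp add: mod_Suc_eq)
qed auto

lemma u_path_mult: "(loop 0 ^^ i) x = u_path 0 (i * n) x"
  by (induction i) (auto simp: loop_def u_path_add add.commute[of n])

text \<open>Local nilpotency is a condition at the vertex 0; \<open>n - k\<close> steps lead from
  \<open>k\<close> to 0, and powers of the loop prolong the path.\<close>

lemma locally_nilpotentD:
  assumes "locally_nilpotent" "k < n" "x \<in> U k"
  obtains m where "u_path k m x = 0"
proof -
  have kn: "(k + (n - k)) mod n = 0"
    using assms(2) by simp
  have "u_path k (n - k) x \<in> U 0"
    using u_path_in[OF assms(2,3), of "n - k"] kn by simp
  then obtain i where "u_path 0 (i * n) (u_path k (n - k) x) = 0"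
    using assms(1) unfolding locally_nilpotent_def u_path_mult by blast
  then have "u_path k (n - k + i * n) x = 0"
    unfolding u_path_add kn .
  then show thesis
    by (rule that)
qed

end

section \<open>Invariance under isomorphism\<close>

text \<open>Extending to the ambient space gives access to the theory of linear maps on whole types
  and allows composition with projections.\<close>

lemma (in vector_space_pair) linear_map_on_extend:
  assumes "linear_map_on s1 s2 S T f" "vs1.subspace S"
  obtains g where "Vector_Spaces.linear s1 s2 g" "\<And>x. x \<in> S \<Longrightarrow> g x = f x"
proof -
  have add: "\<And>x y. x \<in> S \<Longrightarrow> y \<in> S \<Longrightarrow> f (x + y) = f x + f y"
    and scale: "\<And>c x. x \<in> S \<Longrightarrow> f (s1 c x) = s2 c (f x)"
    using assms(1) unfolding linear_map_on_def by auto
  obtain B where B: "B \<subseteq> S" "vs1.independent B" "vs1.span B = S"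
    using vs1.basis_of_subspace[OF assms(2)] .
  obtain g where g: "Vector_Spaces.linear s1 s2 g" "\<forall>x\<in>B. g x = f x"
    using linear_independent_extend[OF B(2)] by blast
  interpret g: Vector_Spaces.linear s1 s2 g by (rule g(1))
  have "x \<in> S \<and> g x = f x" if "x \<in> vs1.span B" for x
    using that
  proof (induction rule: vs1.span_induct_alt)
    case base
    then show ?case
      using scale[of 0 0] vs1.subspace_0[OF assms(2)] by (simp add: g.zero)
  next
    case (step c x y)
    then have "x \<in> S" "s1 c x \<in> S"
      using B(1) vs1.subspace_scale[OF assms(2)] by auto
    then show ?case
      using step g(2) add scale vs1.subspace_add[OF assms(2)] by (simp add: g.add g.scale)
  qed
  then show thesis
    using that[OF g(1)] B(3) by blast
qed

locale cyclic_rep_pair = U: cyclic_rep scaleU n U u + V: cyclic_rep scaleV n V v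
  for scaleU :: "'f::field \<Rightarrow> 'a::ab_group_add \<Rightarrow> 'a"
    and scaleV :: "'f \<Rightarrow> 'b::ab_group_add \<Rightarrow> 'b"
    and n U u V v
begin

sublocale vector_space_pair scaleU scaleV
  by unfold_locales

section \<open>Transport of the filtration and the invariants\<close>

context
  fixes \<phi>
  assumes lin: "\<And>k. k < n \<Longrightarrow> linear_map_on scaleU scaleV (U k) (V k) (\<phi> k)"
    and bij: "\<And>k. k < n \<Longrightarrow> bij_betw (\<phi> k) (U k) (V k)"
    and comm: "\<And>k x. k < n \<Longrightarrow> x \<in> U k \<Longrightarrow> v k (\<phi> k x) = \<phi> ((k + 1) mod n) (u k x)"
begin

lemma iso_inj: "k < n \<Longrightarrow> inj_on (\<phi> k) (U k)"
  and iso_image: "k < n \<Longrightarrow> \<phi> k ` U k = V k"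
  using bij unfolding bij_betw_def by blast+

lemma iso_shift:
  assumes "\<And>k. k < n \<Longrightarrow> W k \<subseteq> U k" "\<And>k. k < n \<Longrightarrow> \<phi> k ` W k = W' k" "k < n"
  shows "\<phi> k ` U.shift W k = V.shift W' k"
  using assms(3)
proof (rule U.all_next[rotated])
  fix k
  assume k: "k < n"
  have "\<phi> ((k + 1) mod n) ` u k ` W k = v k ` \<phi> k ` W k"
    unfolding image_image using comm[OF k] assms(1)[OF k] by (intro image_cong) auto
  then show "\<phi> ((k + 1) mod n) ` U.shift W ((k + 1) mod n) = V.shift W' ((k + 1) mod n)"
    unfolding U.shift_next[OF k] V.shift_next[OF k] assms(2)[OF k] .
qed

lemma iso_U_ord: "k < n \<Longrightarrow> \<phi> k ` U.U_ord \<alpha> k = V.U_ord \<alpha> k"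
proof (induction \<alpha> arbitrary: k rule: less_induct)
  case (less \<alpha>)
  consider "{..<\<alpha>} = {}" | \<gamma> where "{..<\<alpha>} = {..\<gamma>}"
    | "{..<\<alpha>} \<noteq> {}" "\<And>\<beta>. {..<\<alpha>} \<noteq> {..\<beta>}"
    by blast
  then show ?case
  proof cases
    case 1
    then show ?thesis
      using iso_image less.prems by (simp add: U.U_ord_zero V.U_ord_zero)
  next
    case (2 \<gamma>)
    then have "\<gamma> < \<alpha>" by auto
    then show ?thesis
      unfolding U.U_ord_succ[OF 2] V.U_ord_succ[OF 2]
      by (intro iso_shift less U.U_ord_subset)
  next
    case 3
    \<comment> \<open>The image commutes with the intersection because \<open>\<phi> k\<close> is
      injective on \<open>U k\<close> and the index set is nonempty.\<close>
    then obtain \<beta> where "\<beta> \<in> {..<\<alpha>}" by blast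
    then have "\<phi> k ` (\<Inter>\<beta>\<in>{..<\<alpha>}. U.U_ord \<beta> k) = (\<Inter>\<beta>\<in>{..<\<alpha>}. \<phi> k ` U.U_ord \<beta> k)"
      using U.U_ord_subset[OF less.prems]
      by (intro image_INT[OF iso_inj[OF less.prems]]) auto
    then show ?thesis
      using less unfolding U.U_ord_limit[OF 3] V.U_ord_limit[OF 3] by auto
  qed
qed

text \<open>The two sides are intersections over ordinals whose types depend on the types of the
  vectors, so they are not compared stage by stage. Both inclusions use the maximality in
  \<open>shift_stable_subset_U_inf\<close>.\<close>

lemma iso_U_inf: "k < n \<Longrightarrow> \<phi> k ` U.U_inf k = V.U_inf k"
proof (intro equalityI)
  assume k: "k < n"
  show "\<phi> k ` U.U_inf k \<subseteq> V.U_inf k"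
  proof (rule V.shift_stable_subset_U_inf[OF _ _ k])
    fix k
    assume k: "k < n"
    show "\<phi> k ` U.U_inf k \<subseteq> V k"
      using U.U_inf_subset iso_image k by blast
    have "\<phi> k ` U.shift U.U_inf k = V.shift (\<lambda>k. \<phi> k ` U.U_inf k) k"
      using U.U_inf_subset k by (intro iso_shift) auto
    then show "\<phi> k ` U.U_inf k \<subseteq> V.shift (\<lambda>k. \<phi> k ` U.U_inf k) k"
      by (simp add: U.shift_U_inf[OF k])
  qed
  \<comment> \<open>For the reverse inclusion, the preimage of \<open>V.U_inf\<close> in
    \<open>U\<close> is shown to equal its own shift.\<close>
  define W where "W k = {x \<in> U k. \<phi> k x \<in> V.U_inf k}" for k
  have W: "\<phi> k ` W k = V.U_inf k" if "k < n" for k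
    using iso_image[OF that] V.U_inf_subset[OF that] by (auto simp: W_def)
  have "W k \<subseteq> U.U_inf k"
  proof (rule U.shift_stable_subset_U_inf[OF _ _ k])
    fix k
    assume k: "k < n"
    show "W k \<subseteq> U k"
      by (auto simp: W_def)
    have sub: "U.shift W k \<subseteq> U k"
      by (rule U.shift_subset[OF _ k]) (auto simp: W_def)
    have "\<phi> k ` U.shift W k = V.shift V.U_inf k"
      using W k by (intro iso_shift) (auto simp: W_def)
    then have "\<phi> k ` U.shift W k = \<phi> k ` W k"
      using W V.shift_U_inf k by simp
    then have "U.shift W k = W k"
      by (rule inj_on_image_eq_iff[OF iso_inj[OF k], THEN iffD1, rotated 2])
        (use sub in \<open>auto simp: W_def\<close>)
    then show "W k \<subseteq> U.shift W k" by simp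
  qed
  then show "V.U_inf k \<subseteq> \<phi> k ` U.U_inf k"
    using W[OF k] by blast
qed

lemma iso_kernel:
  assumes "k < n" "W \<subseteq> U k" "\<phi> k ` W = W'"
  shows "\<phi> k ` (W \<inter> {x. u k x = 0}) = W' \<inter> {y. v k y = 0}"
proof -
  let ?j = "(k + 1) mod n"
  have zero: "\<phi> ?j 0 = 0"
    using lin[OF U.next_less, of k] U.subspace_0[OF U.subspace_U[OF U.next_less]]
      U.scale_zero_left V.scale_zero_left
    unfolding linear_map_on_def by metis
  have "v k (\<phi> k x) = 0 \<longleftrightarrow> u k x = 0" if "x \<in> W" for x
  proof -
    have x: "x \<in> U k"
      using that assms(2) by blast
    have "\<phi> ?j (u k x) = \<phi> ?j 0 \<longleftrightarrow> u k x = 0"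
      using U.u_in[OF assms(1) x] U.subspace_0[OF U.subspace_U[OF U.next_less]]
      by (intro inj_on_eq_iff[OF iso_inj[OF U.next_less]])
    then show ?thesis
      using comm[OF assms(1) x] zero by simp
  qed
  then show ?thesis
    using assms(3) by auto
qed

text \<open>If \<open>p\<close> models the quotient on the \<open>V\<close> side, then
  \<open>p \<circ> g\<close> models it on the \<open>U\<close> side, so one basis \<open>B\<close>
  computes both invariants.\<close>

lemma iso_kappa:
  assumes k: "k < n"
  shows "U.kappa k \<alpha> =o V.kappa k \<alpha>"
proof -
  let ?M = "U.U_ord \<alpha> k \<inter> {x. u k x = 0}" and ?M' = "V.U_ord \<alpha> k \<inter> {x. v k x = 0}"
  obtain g where g: "Vector_Spaces.linear scaleU scaleV g" "\<And>x. x \<in> U k \<Longrightarrow> g x = \<phi> k x"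
    using linear_map_on_extend[OF lin[OF k] U.subspace_U[OF k]] by metis
  obtain p where p: "Vector_Spaces.linear scaleV scaleV p"
    "\<And>y. p y = 0 \<longleftrightarrow> y \<in> V.shift (V.U_ord \<alpha>) k"
    using V.exists_linear_with_kernel[OF V.subspace_shift_U_ord[OF k, of \<alpha>]] by metis
  interpret p: Vector_Spaces.linear scaleV scaleV p by (rule p(1))
  have "V.subspace (p ` ?M')"
    using k by (intro p.subspace_image V.subspace_kernel V.subspace_U_ord V.U_ord_subset)
  then obtain B where B: "V.independent B" "V.span B = p ` ?M'"
    using V.basis_of_subspace by metis
  have "V.kappa k \<alpha> =o |B|"
    using k p(1) _ B by (rule V.kappa_ordIso) (rule p(2))
  moreover have "U.kappa k \<alpha> =o |B|"
    using k _ _ B(1)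
  proof (rule U.kappa_ordIso)
    show "Vector_Spaces.linear scaleU scaleV (p \<circ> g)"
      using g(1) p(1) by (rule Vector_Spaces.linear_compose)
  next
    fix x
    assume x: "x \<in> U.U_ord \<alpha> k"
    then have xU: "x \<in> U k"
      using U.U_ord_subset[OF k] by blast
    have sub: "U.shift (U.U_ord \<alpha>) k \<subseteq> U k"
      using k by (intro U.shift_subset U.U_ord_subset)
    have sh: "\<phi> k ` U.shift (U.U_ord \<alpha>) k = V.shift (V.U_ord \<alpha>) k"
      using k by (intro iso_shift iso_U_ord U.U_ord_subset)
    have "\<phi> k x \<in> V.shift (V.U_ord \<alpha>) k \<longleftrightarrow> x \<in> U.shift (U.U_ord \<alpha>) k"
      using inj_on_image_mem_iff[OF iso_inj[OF k] xU sub] sh by simp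
    then show "(p \<circ> g) x = 0 \<longleftrightarrow> x \<in> U.shift (U.U_ord \<alpha>) k"
      using p(2) g(2)[OF xU] by simp
  next
    have "g ` ?M = \<phi> k ` ?M"
      using g(2) U.U_ord_subset[OF k] by (intro image_cong) auto
    also have "\<dots> = ?M'"
      by (rule iso_kernel[OF k U.U_ord_subset[OF k] iso_U_ord[OF k]])
    finally show "V.span B = (p \<circ> g) ` ?M"
      unfolding B(2) image_comp[symmetric] by simp
  qed
  ultimately show ?thesis
    by (meson ordIso_symmetric ordIso_transitive)
qed

lemma iso_kappa_inf:
  assumes k: "k < n"
  shows "U.kappa_inf k =o V.kappa_inf k"
proof -
  let ?M = "U.U_inf k \<inter> {x. u k x = 0}" and ?M' = "V.U_inf k \<inter> {x. v k x = 0}"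
  obtain g where g: "Vector_Spaces.linear scaleU scaleV g" "\<And>x. x \<in> U k \<Longrightarrow> g x = \<phi> k x"
    using linear_map_on_extend[OF lin[OF k] U.subspace_U[OF k]] by metis
  interpret g: Vector_Spaces.linear scaleU scaleV g by (rule g(1))
  obtain B where B: "B \<subseteq> ?M" "U.independent B" "U.span B = ?M"
    using U.basis_of_subspace[OF U.subspace_kernel[OF k U.subspace_U_inf[OF k] U.U_inf_subset[OF k]]] .
  have MU: "?M \<subseteq> U k"
    using U.U_inf_subset[OF k] by blast
  have "g ` ?M = \<phi> k ` ?M"
    using g(2) MU by (intro image_cong) auto
  also have "\<dots> = ?M'"
    using k U.U_inf_subset iso_U_inf by (intro iso_kernel) auto
  finally have img: "V.span (g ` B) = ?M'"
    unfolding g.span_image B(3) .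
  have inj: "inj_on g ?M"
    using iso_inj[OF k] g(2) MU by (metis (no_types, lifting) inj_on_cong inj_on_subset subsetD)
  have "V.independent (g ` B)"
    using B(2,3) inj by (intro g.independent_injective_image) auto
  then have "V.kappa_inf k =o |g ` B|"
    using img by (rule V.kappa_inf_ordIso)
  moreover have "U.kappa_inf k =o |B|"
    using B(2,3) by (rule U.kappa_inf_ordIso)
  moreover have "|B| =o |g ` B|"
    by (rule card_of_ordIsoI[OF inj_on_imp_bij_betw[OF inj_on_subset[OF inj B(1)]]])
  ultimately show ?thesis
    by (meson ordIso_symmetric ordIso_transitive)
qed

end

end

section \<open>Extension of partial isomorphisms\<close>

locale kaplansky_pair = cyclic_rep_pair scaleU scaleV n U u V v
  for scaleU :: "'f::field \<Rightarrow> 'a::ab_group_add \<Rightarrow> 'a"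
    and scaleV :: "'f \<Rightarrow> 'b::ab_group_add \<Rightarrow> 'b"
    and n U u V v +
  assumes dim_U: "U.dimension \<le>o natLeq" and dim_V: "V.dimension \<le>o natLeq"
    and kappa_eq: "k < n \<Longrightarrow> U.kappa k (\<alpha> :: omega1) =o V.kappa k \<alpha>"
    and kappa_inf_eq: "k < n \<Longrightarrow> U.kappa_inf k =o V.kappa_inf k"
begin

text \<open>By this symmetry, extending the range will be extending the domain for the interchanged
  pair.\<close>

lemma swapped: "kaplansky_pair scaleV scaleU n V v U u"
  by unfold_locales (auto intro: dim_U dim_V ordIso_symmetric[OF kappa_eq] ordIso_symmetric[OF kappa_inf_eq])

text \<open>By \<open>HM\<close>, first components of \<open>H\<close> are congruent to kernel
  vectors modulo the next stage, so \<open>H\<close> compares finite-dimensional parts of the spaces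
  counted by \<open>kappa\<close>. A class missed on the left, that of \<open>m\<close>, forces a
  missed class on the right.\<close>

lemma kappa_outside:
  fixes \<alpha> :: omega1
  assumes k: "k < n"
    and H: "linear_relation scaleU scaleV H" "Domain H \<subseteq> U.span F" "finite F"
    and HW: "\<And>s t. (s, t) \<in> H \<Longrightarrow> s \<in> U.shift (U.U_ord \<alpha>) k \<longleftrightarrow> t \<in> V.shift (V.U_ord \<alpha>) k"
    and HM: "\<And>s t. (s, t) \<in> H \<Longrightarrow> s \<in> U.U_ord \<alpha> k \<and> u k s \<in> u k ` U.shift (U.U_ord \<alpha>) k"
    and m: "m \<in> U.U_ord \<alpha> k" "u k m = 0" "\<And>s t. (s, t) \<in> H \<Longrightarrow> m - s \<notin> U.shift (U.U_ord \<alpha>) k"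
  obtains m' where "m' \<in> V.U_ord \<alpha> k" "v k m' = 0"
    "\<And>s t. (s, t) \<in> H \<Longrightarrow> m' - t \<notin> V.shift (V.U_ord \<alpha>) k"
proof -
  let ?M1 = "U.U_ord \<alpha> k \<inter> {x. u k x = 0}" and ?M2 = "V.U_ord \<alpha> k \<inter> {x. v k x = 0}"
  have M1: "U.subspace ?M1" and M2: "V.subspace ?M2"
    using k by (auto intro!: U.subspace_kernel U.subspace_U_ord U.U_ord_subset
        V.subspace_kernel V.subspace_U_ord V.U_ord_subset)
  obtain p1 where p1: "Vector_Spaces.linear scaleU scaleU p1"
    "\<And>x. p1 x = 0 \<longleftrightarrow> x \<in> U.shift (U.U_ord \<alpha>) k"
    using U.exists_linear_with_kernel[OF U.subspace_shift_U_ord[OF k, of \<alpha>]] by metis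
  obtain p2 where p2: "Vector_Spaces.linear scaleV scaleV p2"
    "\<And>x. p2 x = 0 \<longleftrightarrow> x \<in> V.shift (V.U_ord \<alpha>) k"
    using V.exists_linear_with_kernel[OF V.subspace_shift_U_ord[OF k, of \<alpha>]] by metis
  interpret p1: Vector_Spaces.linear scaleU scaleU p1 by (rule p1(1))
  interpret p2: Vector_Spaces.linear scaleV scaleV p2 by (rule p2(1))
  obtain B1 where B1: "U.independent B1" "U.span B1 = p1 ` ?M1"
    using U.basis_of_subspace[OF p1.subspace_image[OF M1]] by metis
  obtain B2 where B2: "V.independent B2" "V.span B2 = p2 ` ?M2"
    using V.basis_of_subspace[OF p2.subspace_image[OF M2]] by metis
  have "U.kappa k \<alpha> =o |B1|"
    using k p1(1) _ B1 by (rule U.kappa_ordIso) (rule p1(2))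
  moreover have "V.kappa k \<alpha> =o |B2|"
    using k p2(1) _ B2 by (rule V.kappa_ordIso) (rule p2(2))
  ultimately have card: "|B1| =o |B2|"
    using kappa_eq[OF k, of \<alpha>] by (meson ordIso_symmetric ordIso_transitive)
  have HM': "p1 ` Domain H \<subseteq> p1 ` ?M1"
  proof clarify
    fix s t
    assume "(s, t) \<in> H"
    then obtain y where s: "s \<in> U.U_ord \<alpha> k" and y: "y \<in> U.shift (U.U_ord \<alpha>) k" "u k s = u k y"
      using HM by blast
    have yW: "y \<in> U.U_ord \<alpha> k"
      using y(1) U.shift_U_ord_subset[OF k] by blast
    \<comment> \<open>\<open>s\<close> itself may survive under \<open>u k\<close>, but
      \<open>s - y\<close> is a kernel vector with the same class.\<close>
    have "s - y \<in> ?M1"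
      using U.subspace_diff[OF U.subspace_U_ord[OF k] s yW] U.u_diff[OF k, of s y] s yW y(2)
        U.U_ord_subset[OF k, of \<alpha>] by auto
    moreover have "p1 (s - y) = p1 s"
      using p1(2)[of y] y(1) by (simp add: p1.diff)
    ultimately show "p1 s \<in> p1 ` ?M1"
      by (metis imageI)
  qed
  have m': "p1 m \<notin> p1 ` Domain H"
  proof
    assume "p1 m \<in> p1 ` Domain H"
    then obtain s t where "(s, t) \<in> H" "p1 (m - s) = 0"
      by (auto simp: p1.diff)
    then show False
      using m(3) p1(2) by blast
  qed
  obtain m' where m': "m' \<in> ?M2" "p2 m' \<notin> p2 ` Range H"
    using exists_outside_Range[OF p1(1) p2(1) p1(2) p2(2) B1(2) B2 card H HW HM' _ m'] m(1,2)
    by blast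
  show thesis
  proof (rule that)
    fix s t
    assume "(s, t) \<in> H"
    then have "p2 (m' - t) \<noteq> 0"
      using m'(2) by (auto simp: p2.diff)
    then show "m' - t \<notin> V.shift (V.U_ord \<alpha>) k"
      using p2(2) by blast
  qed (use m'(1) in auto)
qed

lemma kappa_inf_outside:
  assumes k: "k < n"
    and H: "linear_relation scaleU scaleV H" "Domain H \<subseteq> U.span F" "finite F"
    and HW: "\<And>s t. (s, t) \<in> H \<Longrightarrow> s = 0 \<longleftrightarrow> t = 0"
    and HM: "\<And>s t. (s, t) \<in> H \<Longrightarrow> s \<in> U.U_inf k \<and> u k s = 0"
    and m: "m \<in> U.U_inf k" "u k m = 0" "m \<notin> Domain H"
  obtains m' where "m' \<in> V.U_inf k" "v k m' = 0" "m' \<notin> Range H"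
proof -
  let ?M1 = "U.U_inf k \<inter> {x. u k x = 0}" and ?M2 = "V.U_inf k \<inter> {x. v k x = 0}"
  have M1: "U.subspace ?M1" and M2: "V.subspace ?M2"
    using k by (auto intro!: U.subspace_kernel U.subspace_U_inf U.U_inf_subset
        V.subspace_kernel V.subspace_U_inf V.U_inf_subset)
  obtain B1 where B1: "U.independent B1" "U.span B1 = ?M1"
    using U.basis_of_subspace[OF M1] by metis
  obtain B2 where B2: "V.independent B2" "V.span B2 = ?M2"
    using V.basis_of_subspace[OF M2] by metis
  have card: "|B1| =o |B2|"
    using U.kappa_inf_ordIso[OF B1] V.kappa_inf_ordIso[OF B2] kappa_inf_eq[OF k]
    by (meson ordIso_symmetric ordIso_transitive)
  obtain m' where "m' \<in> ?M2" "id m' \<notin> id ` Range H"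
  \<comment> \<open>At infinity nothing is divided out, so both quotient maps are the
    identity.\<close>
  proof (rule exists_outside_Range[OF U.linear_id V.linear_id, where ?W1.0 = "{0}" and ?W2.0 = "{0}"])
    show "U.span B1 = id ` ?M1" "V.independent B2" "V.span B2 = id ` ?M2" "|B1| =o |B2|"
      using B1 B2 card by auto
    show "m \<in> ?M1" "id m \<notin> id ` Domain H"
      using m by auto
  qed (use H HW HM in auto)
  then show thesis
    using that by auto
qed

text \<open>For a linear relation, \<open>x = 0 \<longleftrightarrow> y = 0\<close> says that it is
  single-valued and injective. All conditions are symmetric under taking converses; infinite height
  is covered through \<open>U_inf_eq_omega1\<close>.\<close>

definition partial_iso :: "(nat \<Rightarrow> ('a \<times> 'b) set) \<Rightarrow> bool"
  where "partial_iso G \<longleftrightarrow> (\<forall>k<n. linear_relation scaleU scaleV (G k) \<and>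
    (\<exists>F. finite F \<and> Domain (G k) \<subseteq> U.span F) \<and> (\<exists>F. finite F \<and> Range (G k) \<subseteq> V.span F) \<and>
    (\<forall>x y. (x, y) \<in> G k \<longrightarrow> x \<in> U k \<and> y \<in> V k \<and> (x = 0 \<longleftrightarrow> y = 0) \<and>
      (u k x, v k y) \<in> G ((k + 1) mod n) \<and>
      (\<forall>\<alpha>::omega1. x \<in> U.U_ord \<alpha> k \<longleftrightarrow> y \<in> V.U_ord \<alpha> k)))"

section \<open>Immediate properties of partial isomorphisms\<close>

context
  fixes G k
  assumes G: "partial_iso G" and k: "k < n"
begin

lemma partial_iso_linear: "linear_relation scaleU scaleV (G k)"
  and partial_iso_finite_Domain: "\<exists>F. finite F \<and> Domain (G k) \<subseteq> U.span F"
  and partial_iso_finite_Range: "\<exists>F. finite F \<and> Range (G k) \<subseteq> V.span F"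
  and partial_iso_in: "(x, y) \<in> G k \<Longrightarrow> x \<in> U k" "(x, y) \<in> G k \<Longrightarrow> y \<in> V k"
  and partial_iso_zero: "(x, y) \<in> G k \<Longrightarrow> x = 0 \<longleftrightarrow> y = 0"
  and partial_iso_next: "(x, y) \<in> G k \<Longrightarrow> (u k x, v k y) \<in> G ((k + 1) mod n)"
  and partial_iso_height: "(x, y) \<in> G k \<Longrightarrow> x \<in> U.U_ord \<alpha> k \<longleftrightarrow> y \<in> V.U_ord (\<alpha>::omega1) k"
  using G k unfolding partial_iso_def by blast+

text \<open>The shift of a stage is the stage at the successor ordinal, which again lies in
  \<open>omega1\<close>.\<close>

lemma partial_iso_shift:
  fixes \<alpha> :: omega1
  assumes "(x, y) \<in> G k"
  shows "x \<in> U.shift (U.U_ord \<alpha>) k \<longleftrightarrow> y \<in> V.shift (V.U_ord \<alpha>) k"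
proof -
  obtain \<gamma> where \<gamma>: "{..<\<gamma>} = {..\<alpha>}"
    by (rule omega1_successor)
  show ?thesis
    using partial_iso_height[OF assms, of \<gamma>] by (simp add: U.U_ord_succ[OF \<gamma>] V.U_ord_succ[OF \<gamma>])
qed

lemma partial_iso_inf:
  assumes "(x, y) \<in> G k"
  shows "x \<in> U.U_inf k \<longleftrightarrow> y \<in> V.U_inf k"
  using partial_iso_height[OF assms]
  by (simp add: U.U_inf_eq_omega1[OF dim_U k] V.U_inf_eq_omega1[OF dim_V k])

end

lemma partial_iso_shift_shift:
  fixes \<alpha> :: omega1
  assumes "partial_iso G" "k < n" "(x, y) \<in> G k"
  shows "x \<in> U.shift (U.shift (U.U_ord \<alpha>)) k \<longleftrightarrow> y \<in> V.shift (V.shift (V.U_ord \<alpha>)) k"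
proof -
  obtain \<gamma> where \<gamma>: "{..<\<gamma>} = {..\<alpha>}"
    by (rule omega1_successor)
  show ?thesis
    using partial_iso_shift[OF assms, of \<gamma>] by (simp add: U.U_ord_succ[OF \<gamma>] V.U_ord_succ[OF \<gamma>])
qed

text \<open>The maps carry \<open>U_inf\<close> onto \<open>U_inf\<close>, so \<open>z\<close> has a
  preimage \<open>w\<close> in \<open>V.U_inf\<close>. If \<open>w\<close> is already the partner of
  some \<open>s\<close>, then \<open>x - s\<close> is a kernel vector outside the domain, and
  equality of \<open>kappa_inf\<close> supplies a new kernel vector to add to
  \<open>w\<close>.\<close>

lemma exists_partner_infinite_height:
  assumes G: "partial_iso G" and k: "k < n"
    and x: "x \<in> U.U_inf k" "x \<notin> Domain (G k)" "(u k x, z) \<in> G ((k + 1) mod n)"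
  obtains w where "w \<in> V.U_inf k" "w \<notin> Range (G k)" "v k w = z"
proof -
  note L = partial_iso_linear[OF G k]
  have "u k x \<in> U.U_inf ((k + 1) mod n)"
    using U.u_image_U_inf[OF k] x(1) by blast
  then have "z \<in> V.U_inf ((k + 1) mod n)"
    using partial_iso_inf[OF G U.next_less x(3)] by simp
  then obtain w where w: "w \<in> V.U_inf k" "v k w = z"
    unfolding V.u_image_U_inf[OF k, symmetric] by blast
  show thesis
  proof (cases "w \<in> Range (G k)")
    case False
    show ?thesis
      by (rule that[OF w(1) False w(2)])
  next
    case True
    then obtain s where s: "(s, w) \<in> G k"
      by blast
    \<comment> \<open>The second component is zero by the choice of \<open>w\<close>, hence so is
      the first.\<close>
    have "(u k x - u k s, z - v k w) \<in> G ((k + 1) mod n)"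
      by (rule linear_relation_diff[OF partial_iso_linear[OF G U.next_less] x(3)
        partial_iso_next[OF G k s]])
    then have us: "u k x = u k s"
      using partial_iso_zero[OF G U.next_less] w(2) by (metis eq_iff_diff_eq_0)
    have sU: "s \<in> U.U_inf k"
      using partial_iso_inf[OF G k s] w(1) by blast
    define H where "H = {(s, t) \<in> G k. s \<in> U.U_inf k \<and> u k s = 0}"
    obtain F where F: "finite F" "Domain (G k) \<subseteq> U.span F"
      using partial_iso_finite_Domain[OF G k] by blast
    have m: "x - s \<in> U.U_inf k"
      using U.subspace_diff[OF U.subspace_U_inf[OF k] x(1) sU] .
    have um: "u k (x - s) = 0"
      using U.u_diff[OF k, of x s] us x(1) sU U.U_inf_subset[OF k] by auto
    have xs: "x - s \<notin> Domain (G k)"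
    proof
      assume "x - s \<in> Domain (G k)"
      then have "x - s + s \<in> Domain (G k)"
        using s by (intro U.subspace_add[OF subspace_Domain[OF L]]) auto
      then show False
        using x(2) by simp
    qed
    have H: "linear_relation scaleU scaleV H"
      using L U.subspace_kernel[OF k U.subspace_U_inf[OF k] U.U_inf_subset[OF k]]
      unfolding H_def linear_relation_def U.subspace_def by auto
    obtain m' where m': "m' \<in> V.U_inf k" "v k m' = 0" "m' \<notin> Range H"
    proof (rule kappa_inf_outside[OF k H _ F(1) _ _ m um])
      show "Domain H \<subseteq> U.span F" "x - s \<notin> Domain H"
        using F(2) xs by (auto simp: H_def)
      show "a = 0 \<longleftrightarrow> b = 0" if "(a, b) \<in> H" for a b
        using that partial_iso_zero[OF G k] by (auto simp: H_def)
      show "a \<in> U.U_inf k \<and> u k a = 0" if "(a, b) \<in> H" for a b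
        using that by (auto simp: H_def)
    qed
    \<comment> \<open>A partner of \<open>m'\<close> would lie in \<open>U_inf\<close> and in the
      kernel, so the pair would belong to \<open>H\<close>.\<close>
    have "m' \<notin> Range (G k)"
    proof
      assume "m' \<in> Range (G k)"
      then obtain a where a: "(a, m') \<in> G k" by blast
      then have "u k a = 0"
        using partial_iso_zero[OF G U.next_less partial_iso_next[OF G k a]] m'(2) by simp
      then show False
        using a m' partial_iso_inf[OF G k a] by (auto simp: H_def)
    qed
    then have "w + m' \<notin> Range (G k)"
      using linear_relation_diff[OF L _ s, of _ "w + m'"] by auto
    moreover have "v k (w + m') = z"
      using V.u_add[OF k, of w m'] w m' V.U_inf_subset[OF k] by auto
    moreover have "w + m' \<in> V.U_inf k"
      using V.subspace_add[OF V.subspace_U_inf[OF k] w(1) m'(1)] .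
    ultimately show ?thesis
      using that by blast
  qed
qed

end

lemma (in vector_space) subspace_add_mem_iff:
  "subspace S \<Longrightarrow> x \<in> S \<Longrightarrow> x + y \<in> S \<longleftrightarrow> y \<in> S"
  using subspace_add[of S x y] subspace_diff[of S "x + y" x] by auto

lemma (in vector_space) subspace_scale_mem_iff:
  "subspace S \<Longrightarrow> c \<noteq> 0 \<Longrightarrow> scale c x \<in> S \<longleftrightarrow> x \<in> S"
  using subspace_scale[of S x c] subspace_scale[of S "scale c x" "inverse c"] by auto

section \<open>Partners of finite height and one-vector extensions\<close>

context kaplansky_pair
begin

text \<open>\<open>proper\<close> says that \<open>x\<close> has height exactly \<beta> and that no
  element of \<open>x + Domain (G k)\<close> is higher; \<open>w\<close> must be proper in the same
  sense. Passing to \<open>x + s0\<close> is allowed because \<open>s0\<close> already has a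
  partner.\<close>

lemma exists_partner_finite_height:
  fixes \<beta> :: omega1
  assumes G: "partial_iso G" and k: "k < n"
    and x: "x \<in> U.U_ord \<beta> k" "(u k x, z) \<in> G ((k + 1) mod n)"
    and proper: "\<And>s t. (s, t) \<in> G k \<Longrightarrow> x + s \<notin> U.shift (U.U_ord \<beta>) k"
  obtains s0 t0 w where "(s0, t0) \<in> G k" "x + s0 \<in> U.U_ord \<beta> k" "w \<in> V.U_ord \<beta> k"
    "(u k (x + s0), v k w) \<in> G ((k + 1) mod n)"
    "\<And>s t. (s, t) \<in> G k \<Longrightarrow> w + t \<notin> V.shift (V.U_ord \<beta>) k"
proof -
  let ?j = "(k + 1) mod n"
  let ?U' = "U.shift (U.U_ord \<beta>)" and ?V' = "V.shift (V.U_ord \<beta>)"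
  note j = U.next_less[of k]
  note L = partial_iso_linear[OF G k] and Lj = partial_iso_linear[OF G j]
  have U'U: "?U' k \<subseteq> U.U_ord \<beta> k" and V'V: "?V' k \<subseteq> V.U_ord \<beta> k"
    using U.shift_U_ord_subset[OF k] V.shift_U_ord_subset[OF k] by auto
  have UU: "U.U_ord \<beta> k \<subseteq> U k" and VV: "V.U_ord \<beta> k \<subseteq> V k"
    using U.U_ord_subset[OF k] V.U_ord_subset[OF k] by auto
  have inU: "a \<in> U k" if "a \<in> U.U_ord \<beta> k" for a
    using that UU by blast
  have inV: "b \<in> V k" if "b \<in> V.U_ord \<beta> k" for b
    using that VV by blast
  have subU: "U.subspace (U.U_ord \<beta> k)" and subV: "V.subspace (V.U_ord \<beta> k)"
    and subU': "U.subspace (?U' k)" and subV': "V.subspace (?V' k)"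
    using k by (auto intro: U.subspace_U_ord V.subspace_U_ord U.subspace_shift_U_ord V.subspace_shift_U_ord)
  have U'': "U.shift ?U' ?j = u k ` ?U' k" and V'': "V.shift ?V' ?j = v k ` ?V' k"
    using U.shift_next[OF k] V.shift_next[OF k] by auto
  have mem_V': "t \<in> V.U_ord \<beta> k" if "w \<in> V.U_ord \<beta> k" "w + t \<in> ?V' k" for w t
    using that V'V V.subspace_add_mem_iff[OF subV that(1)] by blast
  show thesis
  \<comment> \<open>The image of \<open>?U' k\<close> under \<open>u k\<close> is stage \<beta> + 2
    at the next vertex, one stage deeper than the height of \<open>x\<close> alone ensures.\<close>
  proof (cases "\<exists>s t. (s, t) \<in> G k \<and> s \<in> U.U_ord \<beta> k \<and> u k (x + s) \<in> u k ` ?U' k")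
    case False
    have "u k x \<in> ?U' ?j"
      using x(1) U.shift_next[OF k] by blast
    then have "z \<in> ?V' ?j"
      using partial_iso_shift[OF G j x(2)] by blast
    then obtain w where w: "w \<in> V.U_ord \<beta> k" "v k w = z"
      unfolding V.shift_next[OF k] by blast
    show thesis
    proof (rule that)
      show "(0, 0) \<in> G k"
        by (rule linear_relation_zero[OF L])
      show "x + 0 \<in> U.U_ord \<beta> k" "(u k (x + 0), v k w) \<in> G ?j"
        using x w(2) by auto
      show "w \<in> V.U_ord \<beta> k" by (rule w(1))
      fix s t
      assume st: "(s, t) \<in> G k"
      \<comment> \<open>Otherwise \<open>u k (x + s)\<close>, being related to
        \<open>v k (w + t)\<close>, would lie in stage \<beta> + 2, against the case
        assumption.\<close>
      show "w + t \<notin> ?V' k"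
      proof
        assume wt: "w + t \<in> ?V' k"
        then have t: "t \<in> V.U_ord \<beta> k"
          using mem_V'[OF w(1)] by blast
        then have s: "s \<in> U.U_ord \<beta> k"
          using partial_iso_height[OF G k st] by blast
        have "(u k x + u k s, z + v k t) \<in> G ?j"
          by (rule linear_relation_add[OF Lj x(2) partial_iso_next[OF G k st]])
        moreover have "u k x + u k s = u k (x + s)"
          by (rule U.u_add[OF k inU[OF x(1)] inU[OF s], symmetric])
        moreover have "z + v k t = v k (w + t)"
          using V.u_add[OF k inV[OF w(1)] inV[OF t]] w(2) by simp
        ultimately have "(u k (x + s), v k (w + t)) \<in> G ?j"
          by simp
        then have "u k (x + s) \<in> U.shift ?U' ?j \<longleftrightarrow> v k (w + t) \<in> V.shift ?V' ?j"
          by (rule partial_iso_shift_shift[OF G j])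
        then have "u k (x + s) \<in> u k ` ?U' k"
          using wt unfolding U'' V'' by blast
        then show False
          using False st s by blast
      qed
    qed
  next
    case True
    then obtain s1 t1 y where s1: "(s1, t1) \<in> G k" "s1 \<in> U.U_ord \<beta> k"
      and y: "y \<in> ?U' k" "u k (x + s1) = u k y"
      by blast
    \<comment> \<open>\<open>x1\<close> replaces \<open>x\<close>: its image comes from some
      \<open>y\<close> in the next stage, and therefore \<open>z1\<close> comes from some
      \<open>y'\<close> in the next stage on the other side.\<close>
    define x1 z1 where "x1 = x + s1" and "z1 = z + v k t1"
    have x1: "x1 \<in> U.U_ord \<beta> k"
      unfolding x1_def using U.subspace_add[OF subU x(1) s1(2)] .
    have "u k x1 = u k x + u k s1"
      unfolding x1_def using U.u_add[OF k inU[OF x(1)] inU[OF s1(2)]] .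
    then have ux1: "(u k x1, z1) \<in> G ?j"
      unfolding z1_def using linear_relation_add[OF Lj x(2) partial_iso_next[OF G k s1(1)]] by simp
    have "u k x1 \<in> u k ` ?U' k"
      using y unfolding x1_def by blast
    then have "z1 \<in> v k ` ?V' k"
      using partial_iso_shift_shift[OF G j ux1, of \<beta>] unfolding U'' V'' by blast
    then obtain y' where y': "y' \<in> ?V' k" "z1 = v k y'"
      by blast
    have proper1: "x1 + s \<notin> ?U' k" if "(s, t) \<in> G k" for s t
      using proper[OF linear_relation_add[OF L s1(1) that]] by (simp add: x1_def add.assoc)
    \<comment> \<open>Only pairs whose first component is, modulo the next stage, a kernel vector of
      stage \<beta> can interfere with the class of a kernel vector.\<close>
    define H where "H = {(s, t) \<in> G k. s \<in> U.U_ord \<beta> k \<and> u k s \<in> u k ` ?U' k}"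
    have sub'': "U.subspace (u k ` ?U' k)"
      using subU' U'U UU by (intro U.subspace_u_image[OF k]) auto
    have H: "linear_relation scaleU scaleV H"
      unfolding linear_relation_def
    proof (intro conjI allI impI)
      show "(0, 0) \<in> H"
        using linear_relation_zero[OF L] U.subspace_0[OF subU] U.subspace_0[OF sub''] U.u_zero[OF k]
        by (simp add: H_def)
    next
      fix a b a' b'
      assume "(a, b) \<in> H" "(a', b') \<in> H"
      then show "(a + a', b + b') \<in> H"
        using linear_relation_add[OF L, of a b a' b'] U.subspace_add[OF subU, of a a']
          U.subspace_add[OF sub'', of "u k a" "u k a'"] U.u_add[OF k, of a a'] UU
        by (auto simp: H_def subset_iff)
    next
      fix c a b
      assume "(a, b) \<in> H"
      then show "(scaleU c a, scaleV c b) \<in> H"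
        using linear_relation_scale[OF L, of a b c] U.subspace_scale[OF subU, of a c]
          U.subspace_scale[OF sub'', of "u k a" c] U.u_scale[OF k, of a c] UU
        by (auto simp: H_def subset_iff)
    qed
    obtain F where F: "finite F" "Domain (G k) \<subseteq> U.span F"
      using partial_iso_finite_Domain[OF G k] by blast
    have yU: "y \<in> U.U_ord \<beta> k"
      using y(1) U'U by blast
    \<comment> \<open>The kernel vector \<open>x1 - y\<close> inherits properness from
      \<open>x1\<close>, because \<open>y\<close> is in the next stage.\<close>
    have m: "x1 - y \<in> U.U_ord \<beta> k"
      using U.subspace_diff[OF subU x1 yU] .
    have um: "u k (x1 - y) = 0"
      using U.u_diff[OF k inU[OF x1] inU[OF yU]] y(2) unfolding x1_def by simp
    obtain m' where m': "m' \<in> V.U_ord \<beta> k" "v k m' = 0" "\<And>s t. (s, t) \<in> H \<Longrightarrow> m' - t \<notin> ?V' k"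
    proof (rule kappa_outside[OF k H _ F(1) _ _ m um])
      show "Domain H \<subseteq> U.span F"
        using F(2) by (auto simp: H_def)
    next
      fix s t
      assume st: "(s, t) \<in> H"
      then have G': "(s, t) \<in> G k"
        by (simp add: H_def)
      show "s \<in> ?U' k \<longleftrightarrow> t \<in> ?V' k"
        by (rule partial_iso_shift[OF G k G'])
      show "s \<in> U.U_ord \<beta> k \<and> u k s \<in> u k ` ?U' k"
        using st by (simp add: H_def)
      show "x1 - y - s \<notin> ?U' k"
      proof
        assume "x1 - y - s \<in> ?U' k"
        then have "x1 - y - s + y \<in> ?U' k"
          using y(1) U.subspace_add[OF subU'] by blast
        then have "x1 + (- s) \<in> ?U' k"
          by simp
        moreover have "(- s, - t) \<in> G k"
          using linear_relation_diff[OF L linear_relation_zero[OF L] G'] by simp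
        ultimately show False
          using proper1 by blast
      qed
    qed blast
    have y'V: "y' \<in> V.U_ord \<beta> k"
      using y'(1) V'V by blast
    \<comment> \<open>\<open>y'\<close> provides the prescribed image \<open>z1\<close>, and the
      kernel vector \<open>m'\<close> makes \<open>w\<close> proper.\<close>
    define w where "w = m' + y'"
    have w: "w \<in> V.U_ord \<beta> k"
      unfolding w_def using V.subspace_add[OF subV m'(1) y'V] .
    have "v k w = z1"
      using V.u_add[OF k inV[OF m'(1)] inV[OF y'V]] m'(2) y'(2) unfolding w_def by simp
    show thesis
    proof (rule that[OF s1(1) _ w])
      show "x + s1 \<in> U.U_ord \<beta> k" "(u k (x + s1), v k w) \<in> G ?j"
        using x1 ux1 \<open>v k w = z1\<close> unfolding x1_def by auto
      fix s t
      assume st: "(s, t) \<in> G k"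
      show "w + t \<notin> ?V' k"
      proof
        assume wt: "w + t \<in> ?V' k"
        then have "w + t - y' \<in> ?V' k"
          using y'(1) V.subspace_diff[OF subV'] by blast
        then have mt: "m' + t \<in> ?V' k"
          by (simp add: w_def)
        have t: "t \<in> V.U_ord \<beta> k"
          using mem_V'[OF m'(1) mt] .
        then have s: "s \<in> U.U_ord \<beta> k"
          using partial_iso_height[OF G k st] by blast
        \<comment> \<open>So \<open>v k t\<close> is the image of a vector in the next stage, and
          the pair falls into \<open>H\<close>, where \<open>m'\<close> avoids the class of
          \<open>- t\<close>.\<close>
        have "v k t = v k (m' + t)"
          using V.u_add[OF k inV[OF m'(1)] inV[OF t]] m'(2) by simp
        then have "v k t \<in> v k ` ?V' k"
          using mt by blast
        then have "u k s \<in> u k ` ?U' k"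
          using partial_iso_shift_shift[OF G j partial_iso_next[OF G k st], of \<beta>]
          unfolding U'' V'' by blast
        then have "(- s, - t) \<in> H"
          using linear_relation_diff[OF H linear_relation_zero[OF H], of s t] st s
          by (simp add: H_def)
        then have "m' - (- t) \<notin> ?V' k"
          by (rule m'(3))
        then show False
          using mt by simp
      qed
    qed
  qed
qed

text \<open>For \<alpha> \<le> \<beta>, both \<open>x\<close> and \<open>w\<close> lie in stage
  \<alpha>, so only \<open>s\<close> and \<open>t\<close> matter; for larger \<alpha>, properness
  excludes both sums.\<close>

lemma height_add_iff:
  fixes \<alpha> \<beta> :: omega1
  assumes G: "partial_iso G" and k: "k < n"
    and x: "x \<in> U.U_ord \<beta> k" "\<And>s t. (s, t) \<in> G k \<Longrightarrow> x + s \<notin> U.shift (U.U_ord \<beta>) k"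
    and w: "w \<in> V.U_ord \<beta> k" "\<And>s t. (s, t) \<in> G k \<Longrightarrow> w + t \<notin> V.shift (V.U_ord \<beta>) k"
    and st: "(s, t) \<in> G k"
  shows "x + s \<in> U.U_ord \<alpha> k \<longleftrightarrow> w + t \<in> V.U_ord \<alpha> k"
proof (cases "\<alpha> \<le> \<beta>")
  case True
  then have "x \<in> U.U_ord \<alpha> k" "w \<in> V.U_ord \<alpha> k"
    using x(1) w(1) U.U_ord_antimono[OF True k] V.U_ord_antimono[OF True k] by auto
  then show ?thesis
    using partial_iso_height[OF G k st]
    by (simp add: U.subspace_add_mem_iff[OF U.subspace_U_ord[OF k]]
        V.subspace_add_mem_iff[OF V.subspace_U_ord[OF k]])
next
  case False
  then have "\<beta> < \<alpha>" by simp
  then show ?thesis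
    using U.U_ord_subset_shift[of \<beta> \<alpha> k] V.U_ord_subset_shift[of \<beta> \<alpha> k] k x(2)[OF st] w(2)[OF st]
    by blast
qed

text \<open>Finite dimension yields an element of maximal height in \<open>x + Domain (G k)\<close>,
  and according to its height one of the two constructions applies. The final equivalence is what
  inserting the pair requires.\<close>

lemma exists_partner:
  assumes G: "partial_iso G" and k: "k < n"
    and x: "x \<in> U k" "x \<notin> Domain (G k)" "u k x \<in> Domain (G ((k + 1) mod n))"
  obtains s0 t0 w where "(s0, t0) \<in> G k" "w \<in> V k" "w \<notin> Range (G k)"
    "(u k (x + s0), v k w) \<in> G ((k + 1) mod n)"
    "\<And>s t \<alpha>. (s, t) \<in> G k \<Longrightarrow> x + s0 + s \<in> U.U_ord (\<alpha>::omega1) k \<longleftrightarrow> w + t \<in> V.U_ord \<alpha> k"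
proof -
  note L = partial_iso_linear[OF G k] and Lj = partial_iso_linear[OF G U.next_less]
  obtain F where F: "finite F" "Domain (G k) \<subseteq> U.span F"
    using partial_iso_finite_Domain[OF G k] by blast
  obtain s1 where s1: "s1 \<in> Domain (G k)"
    "\<And>\<alpha>::omega1. \<And>t. t \<in> Domain (G k) \<Longrightarrow> x + t \<in> U.U_ord \<alpha> k \<Longrightarrow> x + s1 \<in> U.U_ord \<alpha> k"
    using U.exists_proper_representative[where W = "\<lambda>\<alpha>::omega1. U.U_ord \<alpha> k" and x = x,
      OF subspace_Domain[OF L] F(2,1) U.subspace_U_ord[OF k] U.U_ord_antimono[OF _ k]] by metis
  obtain t1 where t1: "(s1, t1) \<in> G k"
    using s1(1) by blast
  define x1 where "x1 = x + s1"
  have x1U: "x1 \<in> U k"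
    unfolding x1_def using x(1) partial_iso_in[OF G k t1] U.subspace_add[OF U.subspace_U[OF k]] by blast
  have best: "x1 \<in> U.U_ord \<alpha> k" if "(s, t) \<in> G k" "x1 + s \<in> U.U_ord \<alpha> k" for s t and \<alpha> :: omega1
    using s1(2)[of "s1 + s" \<alpha>] linear_relation_add[OF L t1 that(1)] that(2)
    by (auto simp: x1_def add.assoc)
  have x1D: "x1 \<notin> Domain (G k)"
  proof
    assume "x1 \<in> Domain (G k)"
    then have "x1 - s1 \<in> Domain (G k)"
      using s1(1) by (rule U.subspace_diff[OF subspace_Domain[OF L]])
    then show False
      using x(2) by (simp add: x1_def)
  qed
  obtain z where z: "(u k x, z) \<in> G ((k + 1) mod n)"
    using x(3) by blast
  have "u k x1 = u k x + u k s1"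
    unfolding x1_def using U.u_add[OF k x(1) partial_iso_in(1)[OF G k t1]] .
  then have z1: "(u k x1, z + v k t1) \<in> G ((k + 1) mod n)"
    using linear_relation_add[OF Lj z partial_iso_next[OF G k t1]] by simp
  show thesis
  proof (cases "\<forall>\<alpha>::omega1. x1 \<in> U.U_ord \<alpha> k")
    case True
    then have x1inf: "x1 \<in> U.U_inf k"
      by (simp add: U.U_inf_eq_omega1[OF dim_U k])
    obtain w where w: "w \<in> V.U_inf k" "w \<notin> Range (G k)" "v k w = z + v k t1"
      by (rule exists_partner_infinite_height[OF G k x1inf x1D z1])
    show thesis
    proof (rule that[OF t1 _ w(2)])
      show "w \<in> V k"
        using w(1) V.U_inf_subset[OF k] by blast
      show "(u k (x + s1), v k w) \<in> G ((k + 1) mod n)"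
        using z1 w(3) by (simp add: x1_def)
      fix s t and \<alpha> :: omega1
      assume st: "(s, t) \<in> G k"
      have "w \<in> V.U_ord \<alpha> k"
        using w(1) V.U_inf_subset_U_ord[OF k] by blast
      then show "x + s1 + s \<in> U.U_ord \<alpha> k \<longleftrightarrow> w + t \<in> V.U_ord \<alpha> k"
        using partial_iso_height[OF G k st] True
        by (simp add: x1_def[symmetric] U.subspace_add_mem_iff[OF U.subspace_U_ord[OF k]]
            V.subspace_add_mem_iff[OF V.subspace_U_ord[OF k]])
    qed
  next
    case False
    \<comment> \<open>The least stage missing \<open>x1\<close> is not 0, since \<open>x1\<close> is
      in \<open>U k\<close>, nor a limit, since limit stages are intersections. Its predecessor
      \<beta> is the height of \<open>x1\<close>.\<close>
    define \<alpha> :: omega1 where "\<alpha> = (LEAST \<alpha>. x1 \<notin> U.U_ord \<alpha> k)"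
    have \<alpha>: "x1 \<notin> U.U_ord \<alpha> k"
      unfolding \<alpha>_def by (rule LeastI_ex) (use False in blast)
    have below: "x1 \<in> U.U_ord \<beta> k" if "\<beta> < \<alpha>" for \<beta>
      using that unfolding \<alpha>_def by (auto dest: not_less_Least)
    have ne: "{..<\<alpha>} \<noteq> {}"
    proof
      assume "{..<\<alpha>} = {}"
      then show False
        using \<alpha> x1U by (simp add: U.U_ord_zero)
    qed
    obtain \<beta> where \<beta>: "{..<\<alpha>} = {..\<beta>}"
    proof (rule ccontr)
      assume "\<not> thesis"
      then have "\<And>\<beta>. {..<\<alpha>} \<noteq> {..\<beta>}"
        using that by blast
      then show False
        using \<alpha> below U.U_ord_limit[OF ne] by auto
    qed
    have succ: "U.U_ord \<alpha> k = U.shift (U.U_ord \<beta>) k"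
      by (simp add: U.U_ord_succ[OF \<beta>])
    have "\<beta> < \<alpha>"
      using \<beta> by auto
    then have x1\<beta>: "x1 \<in> U.U_ord \<beta> k"
      by (rule below)
    have proper: "x1 + s \<notin> U.shift (U.U_ord \<beta>) k" if "(s, t) \<in> G k" for s t
      using best[OF that, of \<alpha>] \<alpha> succ by auto
    obtain s2 t2 w where s2: "(s2, t2) \<in> G k" "x1 + s2 \<in> U.U_ord \<beta> k"
      and w: "w \<in> V.U_ord \<beta> k" "(u k (x1 + s2), v k w) \<in> G ((k + 1) mod n)"
        "\<And>s t. (s, t) \<in> G k \<Longrightarrow> w + t \<notin> V.shift (V.U_ord \<beta>) k"
    proof (rule exists_partner_finite_height[OF G k x1\<beta> z1])
      show "x1 + s \<notin> U.shift (U.U_ord \<beta>) k" if "(s, t) \<in> G k" for s t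
        by (rule proper[OF that])
    qed (use that in blast)
    show thesis
    proof (rule that)
      show "(s1 + s2, t1 + t2) \<in> G k"
        by (rule linear_relation_add[OF L t1 s2(1)])
      show "w \<in> V k"
        using w(1) V.U_ord_subset[OF k] by blast
      show "(u k (x + (s1 + s2)), v k w) \<in> G ((k + 1) mod n)"
        using w(2) by (simp add: x1_def add.assoc)
      show "w \<notin> Range (G k)"
      proof
        assume "w \<in> Range (G k)"
        then obtain a where "(a, w) \<in> G k"
          by blast
        \<comment> \<open>With \<open>- w\<close> as second component, properness would exclude 0
          from a subspace.\<close>
        then have "(- a, - w) \<in> G k"
          using linear_relation_diff[OF L linear_relation_zero[OF L]] by fastforce
        then have "w + - w \<notin> V.shift (V.U_ord \<beta>) k"
          by (rule w(3))
        then show False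
          using V.subspace_0[OF V.subspace_shift_U_ord[OF k, of \<beta>]] by simp
      qed
      fix s t and \<alpha> :: omega1
      assume st: "(s, t) \<in> G k"
      have "x1 + s2 + s' \<notin> U.shift (U.U_ord \<beta>) k" if "(s', t') \<in> G k" for s' t'
        using proper[OF linear_relation_add[OF L s2(1) that]] by (simp add: add.assoc)
      then show "x + (s1 + s2) + s \<in> U.U_ord \<alpha> k \<longleftrightarrow> w + t \<in> V.U_ord \<alpha> k"
        using height_add_iff[where \<alpha> = \<alpha>, OF G k s2(2) _ w(1) _ st] w(3)
        by (simp add: x1_def add.assoc)
    qed
  qed
qed

text \<open>\<open>R\<close> is the span of \<open>G k\<close> and the new pair.
  \<open>height\<close> treats coefficient 1, and other nonzero coefficients reduce to it by
  scaling; the two non-membership assumptions keep the relation single-valued and injective.\<close>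

lemma partial_iso_insert:
  assumes G: "partial_iso G" and k: "k < n"
    and x: "x \<in> U k" "x \<notin> Domain (G k)" and w: "w \<in> V k" "w \<notin> Range (G k)"
    and xw: "(u k x, v k w) \<in> G ((k + 1) mod n)"
    and height: "\<And>s t \<alpha>. (s, t) \<in> G k \<Longrightarrow>
      x + s \<in> U.U_ord (\<alpha>::omega1) k \<longleftrightarrow> w + t \<in> V.U_ord \<alpha> k"
  obtains G' where "partial_iso G'" "\<And>j. G j \<subseteq> G' j" "(x, w) \<in> G' k"
proof -
  let ?j = "(k + 1) mod n"
  define R where "R = {(s + scaleU c x, t + scaleV c w) | s t c. (s, t) \<in> G k}"
  define G' where "G' = G(k := R)"
  note L = partial_iso_linear[OF G k] and Lj = partial_iso_linear[OF G U.next_less]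
  have GR: "G k \<subseteq> R"
  proof clarify
    fix s t
    assume "(s, t) \<in> G k"
    moreover have "(s, t) = (s + scaleU 0 x, t + scaleV 0 w)"
      by simp
    ultimately show "(s, t) \<in> R"
      unfolding R_def by blast
  qed
  have sub: "G j \<subseteq> G' j" for j
    using GR by (simp add: G'_def)
  have R: "linear_relation scaleU scaleV R"
    unfolding linear_relation_def
  proof (intro conjI allI impI)
    show "(0, 0) \<in> R"
      using GR linear_relation_zero[OF L] by blast
  next
    fix a b a' b'
    assume "(a, b) \<in> R" "(a', b') \<in> R"
    then obtain s t c s' t' c' where *: "a = s + scaleU c x" "b = t + scaleV c w" "(s, t) \<in> G k"
      "a' = s' + scaleU c' x" "b' = t' + scaleV c' w" "(s', t') \<in> G k"
      unfolding R_def by blast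
    then have "a + a' = (s + s') + scaleU (c + c') x" "b + b' = (t + t') + scaleV (c + c') w"
      by (simp_all add: U.scale_left_distrib V.scale_left_distrib algebra_simps)
    moreover have "(s + s', t + t') \<in> G k"
      by (rule linear_relation_add[OF L *(3,6)])
    ultimately show "(a + a', b + b') \<in> R"
      unfolding R_def by blast
  next
    fix d a b
    assume "(a, b) \<in> R"
    then obtain s t c where *: "a = s + scaleU c x" "b = t + scaleV c w" "(s, t) \<in> G k"
      unfolding R_def by blast
    then have "scaleU d a = scaleU d s + scaleU (d * c) x" "scaleV d b = scaleV d t + scaleV (d * c) w"
      by (simp_all add: U.scale_right_distrib V.scale_right_distrib)
    moreover have "(scaleU d s, scaleV d t) \<in> G k"
      by (rule linear_relation_scale[OF L *(3)])
    ultimately show "(scaleU d a, scaleV d b) \<in> R"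
      unfolding R_def by blast
  qed
  obtain F1 F2 where F: "finite F1" "Domain (G k) \<subseteq> U.span F1" "finite F2" "Range (G k) \<subseteq> V.span F2"
    using partial_iso_finite_Domain[OF G k] partial_iso_finite_Range[OF G k] by blast
  have "a \<in> U.span (insert x F1)" "b \<in> V.span (insert w F2)" if ab: "(a, b) \<in> R" for a b
  proof -
    obtain s t c where *: "a = s + scaleU c x" "b = t + scaleV c w" "(s, t) \<in> G k"
      using ab unfolding R_def by blast
    have "s \<in> U.span (insert x F1)" "t \<in> V.span (insert w F2)"
      using *(3) F U.span_mono[of F1 "insert x F1"] V.span_mono[of F2 "insert w F2"] by blast+
    then show "a \<in> U.span (insert x F1)" "b \<in> V.span (insert w F2)"
      unfolding * by (auto intro: U.span_add U.span_scale U.span_base V.span_add V.span_scale V.span_base)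
  qed
  then have finR: "\<exists>F. finite F \<and> Domain R \<subseteq> U.span F" "\<exists>F. finite F \<and> Range R \<subseteq> V.span F"
    using F(1,3) by (auto intro!: exI[of _ "insert x F1"] exI[of _ "insert w F2"])
  have pairs: "a \<in> U k \<and> b \<in> V k \<and> (a = 0 \<longleftrightarrow> b = 0) \<and> (u k a, v k b) \<in> G' ?j \<and>
      (\<forall>\<alpha>::omega1. a \<in> U.U_ord \<alpha> k \<longleftrightarrow> b \<in> V.U_ord \<alpha> k)" if abR: "(a, b) \<in> R" for a b
  proof -
    obtain s t c where *: "a = s + scaleU c x" "b = t + scaleV c w" and st: "(s, t) \<in> G k"
      using abR unfolding R_def by blast
    note stU = partial_iso_in[OF G k st]
    have cx: "scaleU c x \<in> U k" "scaleV c w \<in> V k"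
      using x(1) w(1) U.subspace_scale[OF U.subspace_U[OF k]] V.subspace_scale[OF V.subspace_U[OF k]]
      by auto
    have ab: "a \<in> U k" "b \<in> V k"
      unfolding * using stU cx U.subspace_add[OF U.subspace_U[OF k]] V.subspace_add[OF V.subspace_U[OF k]]
      by auto
    have "(u k s + scaleU c (u k x), v k t + scaleV c (v k w)) \<in> G ?j"
      by (rule linear_relation_add[OF Lj partial_iso_next[OF G k st] linear_relation_scale[OF Lj xw]])
    then have "(u k a, v k b) \<in> G ?j"
      unfolding * U.u_add[OF k stU(1) cx(1)] V.u_add[OF k stU(2) cx(2)]
        U.u_scale[OF k x(1)] V.u_scale[OF k w(1)] .
    \<comment> \<open>Images land in the old relation at \<open>?j\<close>; passing to
      \<open>G' ?j\<close> also covers \<open>n = 1\<close>, where \<open>?j\<close> is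
      \<open>k\<close> itself.\<close>
    then have next': "(u k a, v k b) \<in> G' ?j"
      using sub by blast
    show ?thesis
    proof (cases "c = 0")
      case True
      then have "a = s" "b = t"
        using * by auto
      then show ?thesis
        using ab next' partial_iso_zero[OF G k st] partial_iso_height[OF G k st] by simp
    next
      case False
      have st': "(scaleU (inverse c) s, scaleV (inverse c) t) \<in> G k"
        by (rule linear_relation_scale[OF L st])
      have a: "a = scaleU c (x + scaleU (inverse c) s)" and b: "b = scaleV c (w + scaleV (inverse c) t)"
        using False unfolding * by (simp_all add: U.scale_right_distrib V.scale_right_distrib add.commute)
      have neg: "(- scaleU (inverse c) s, - scaleV (inverse c) t) \<in> G k"
        using linear_relation_diff[OF L linear_relation_zero[OF L] st'] by simp
      have "a \<noteq> 0"
      proof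
        assume "a = 0"
        then have "x = - scaleU (inverse c) s"
          using False unfolding a by (simp add: eq_neg_iff_add_eq_0)
        then show False
          using x(2) neg by blast
      qed
      moreover have "b \<noteq> 0"
      proof
        assume "b = 0"
        then have "w = - scaleV (inverse c) t"
          using False unfolding b by (simp add: eq_neg_iff_add_eq_0)
        then show False
          using w(2) neg by blast
      qed
      moreover have "a \<in> U.U_ord \<alpha> k \<longleftrightarrow> b \<in> V.U_ord \<alpha> k" for \<alpha> :: omega1
        unfolding a b U.subspace_scale_mem_iff[OF U.subspace_U_ord[OF k] False]
          V.subspace_scale_mem_iff[OF V.subspace_U_ord[OF k] False] by (rule height[OF st'])
      ultimately show ?thesis
        using ab next' by blast
    qed
  qed
  have "partial_iso G'"
    unfolding partial_iso_def
  proof (intro allI impI)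
    fix i
    assume i: "i < n"
    have "(a, b) \<in> G i \<Longrightarrow> (u i a, v i b) \<in> G' ((i + 1) mod n)" for a b
      using partial_iso_next[OF G i] sub by blast
    then show "linear_relation scaleU scaleV (G' i) \<and>
        (\<exists>F. finite F \<and> Domain (G' i) \<subseteq> U.span F) \<and> (\<exists>F. finite F \<and> Range (G' i) \<subseteq> V.span F) \<and>
        (\<forall>a b. (a, b) \<in> G' i \<longrightarrow> a \<in> U i \<and> b \<in> V i \<and> (a = 0 \<longleftrightarrow> b = 0) \<and>
          (u i a, v i b) \<in> G' ((i + 1) mod n) \<and>
          (\<forall>\<alpha>::omega1. a \<in> U.U_ord \<alpha> i \<longleftrightarrow> b \<in> V.U_ord \<alpha> i))"
      using i R finR pairs partial_iso_linear[OF G i] partial_iso_finite_Domain[OF G i]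
        partial_iso_finite_Range[OF G i] partial_iso_in[OF G i] partial_iso_zero[OF G i]
        partial_iso_height[OF G i]
      by (cases "i = k") (simp_all add: G'_def)
  qed
  moreover have "(x, w) \<in> G' k"
    using linear_relation_zero[OF L] by (auto simp: G'_def R_def intro!: exI[of _ 0] exI[of _ 1])
  ultimately show thesis
    using that sub by blast
qed

text \<open>A partner is found for a corrected vector \<open>x + s\<close> with \<open>s\<close>
  already in the domain; as domains are subspaces, adding it also adds \<open>x\<close>.\<close>

lemma partial_iso_extend_one:
  assumes G: "partial_iso G" and k: "k < n"
    and x: "x \<in> U k" "u k x \<in> Domain (G ((k + 1) mod n))"
  obtains G' where "partial_iso G'" "\<And>j. G j \<subseteq> G' j" "x \<in> Domain (G' k)"
proof (cases "x \<in> Domain (G k)")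
  case True
  then show ?thesis
    using that[OF G] by blast
next
  case False
  note L = partial_iso_linear[OF G k]
  obtain s t w where s: "(s, t) \<in> G k" and w: "w \<in> V k" "w \<notin> Range (G k)"
    and xw: "(u k (x + s), v k w) \<in> G ((k + 1) mod n)"
    and h: "\<And>s' t' \<alpha>. (s', t') \<in> G k \<Longrightarrow>
      x + s + s' \<in> U.U_ord (\<alpha>::omega1) k \<longleftrightarrow> w + t' \<in> V.U_ord \<alpha> k"
    by (rule exists_partner[OF G k x(1) False x(2)]) (use that in blast)
  have xs: "x + s \<in> U k"
    using U.subspace_add[OF U.subspace_U[OF k] x(1) partial_iso_in(1)[OF G k s]] .
  have "x + s \<notin> Domain (G k)"
  proof
    assume "x + s \<in> Domain (G k)"
    then have "x + s - s \<in> Domain (G k)"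
      using s by (intro U.subspace_diff[OF subspace_Domain[OF L]]) auto
    then show False
      using False by simp
  qed
  then obtain G' where G': "partial_iso G'" "\<And>j. G j \<subseteq> G' j" "(x + s, w) \<in> G' k"
  proof (rule partial_iso_insert[OF G k xs _ w xw])
    show "x + s + s' \<in> U.U_ord (\<alpha>::omega1) k \<longleftrightarrow> w + t' \<in> V.U_ord \<alpha> k" if "(s', t') \<in> G k" for s' t' \<alpha>
      by (rule h[OF that])
  qed (use that in blast)
  have "x + s - s \<in> Domain (G' k)"
    using G'(2)[of k] G'(3) s by (intro U.subspace_diff[OF subspace_Domain[OF partial_iso_linear[OF G'(1) k]]]) auto
  then show ?thesis
    using that[OF G'(1,2)] by simp
qed

text \<open>\<open>u k x\<close> dies one step earlier, so it is added first, and then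
  \<open>x\<close> is a one-vector extension. Length 0 means \<open>x = 0\<close>.\<close>

lemma partial_iso_extend_path:
  assumes "partial_iso G" "k < n" "x \<in> U k" "U.u_path k m x = 0"
  shows "\<exists>G'. partial_iso G' \<and> (\<forall>j. G j \<subseteq> G' j) \<and> x \<in> Domain (G' k)"
  using assms(2-)
proof (induction m arbitrary: k x)
  case 0
  then show ?case
    using linear_relation_zero[OF partial_iso_linear[OF assms(1)], of k] assms(1) by auto
next
  case (Suc m)
  let ?j = "(k + 1) mod n"
  have "U.u_path ?j m (u k x) = 0"
    using Suc.prems(1,3) U.u_path_add[of k 1 m x] by simp
  then obtain G' where G': "partial_iso G'" "\<forall>j. G j \<subseteq> G' j" "u k x \<in> Domain (G' ?j)"
    using Suc.IH[OF U.next_less U.u_in[OF Suc.prems(1,2)]] by blast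
  obtain G'' where "partial_iso G''" "\<And>j. G' j \<subseteq> G'' j" "x \<in> Domain (G'' k)"
    using partial_iso_extend_one[OF G'(1) Suc.prems(1,2) G'(3)] by metis
  then show ?case
    using G'(2) by (metis subset_trans)
qed

lemma partial_iso_extend_Domain:
  assumes "U.locally_nilpotent" "partial_iso G" "k < n" "x \<in> U k"
  shows "\<exists>G'. partial_iso G' \<and> (\<forall>j. G j \<subseteq> G' j) \<and> x \<in> Domain (G' k)"
proof -
  obtain m where "U.u_path k m x = 0"
    by (rule U.locally_nilpotentD[OF assms(1,3,4)])
  then show ?thesis
    by (rule partial_iso_extend_path[OF assms(2-4)])
qed

text \<open>Converses of partial isomorphisms are partial isomorphisms of the interchanged
  pair.\<close>

lemma partial_iso_extend_Range:
  assumes "V.locally_nilpotent" "partial_iso G" "k < n" "y \<in> V k"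
  shows "\<exists>G'. partial_iso G' \<and> (\<forall>j. G j \<subseteq> G' j) \<and> y \<in> Range (G' k)"
proof -
  interpret S: kaplansky_pair scaleV scaleU n V v U u
    by (rule swapped)
  have iff: "S.partial_iso (\<lambda>k. (G k)\<inverse>) \<longleftrightarrow> partial_iso G" for G
    unfolding S.partial_iso_def partial_iso_def linear_relation_converse Domain_converse Range_converse
      converse_iff by blast
  obtain G' where G': "S.partial_iso G'" "\<forall>j. (G j)\<inverse> \<subseteq> G' j" "y \<in> Domain (G' k)"
    using S.partial_iso_extend_Domain[OF assms(1) _ assms(3,4), of "\<lambda>k. (G k)\<inverse>"] assms(2) iff by blast
  have "partial_iso (\<lambda>k. (G' k)\<inverse>)"
    using G'(1) iff[of "\<lambda>k. (G' k)\<inverse>"] by simp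
  moreover have "\<forall>j. G j \<subseteq> (G' j)\<inverse>" "y \<in> Range ((G' k)\<inverse>)"
    using G'(2,3) by auto
  ultimately show ?thesis
    by (intro exI[of _ "\<lambda>k. (G' k)\<inverse>"]) blast
qed

section \<open>The back-and-forth construction\<close>

lemma partial_iso_zero_relation: "partial_iso (\<lambda>_. {(0, 0)})"
  unfolding partial_iso_def linear_relation_def
  using U.subspace_0[OF U.subspace_U] V.subspace_0[OF V.subspace_U] U.u_zero V.u_zero
    U.subspace_0[OF U.subspace_U_ord] V.subspace_0[OF V.subspace_U_ord]
  by (auto intro!: exI[of _ "{}"])

text \<open>Countable spanning sets of all spaces are enumerated, and each stage meets one demand.
  Since the domain and range of the union are subspaces, meeting all demands exhausts both
  representations.\<close>

lemma exists_iso_relation: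
  assumes nil: "U.locally_nilpotent" "V.locally_nilpotent"
  obtains \<Gamma> where "\<And>k. k < n \<Longrightarrow> linear_relation scaleU scaleV (\<Gamma> k)"
    "\<And>k. k < n \<Longrightarrow> Domain (\<Gamma> k) = U k" "\<And>k. k < n \<Longrightarrow> Range (\<Gamma> k) = V k"
    "\<And>k x y. k < n \<Longrightarrow> (x, y) \<in> \<Gamma> k \<Longrightarrow> x = 0 \<longleftrightarrow> y = 0"
    "\<And>k x y. k < n \<Longrightarrow> (x, y) \<in> \<Gamma> k \<Longrightarrow> (u k x, v k y) \<in> \<Gamma> ((k + 1) mod n)"
proof -
  have "\<forall>k. \<exists>A. k < n \<longrightarrow> countable A \<and> A \<subseteq> U k \<and> U.span A = U k"
    using U.countable_spanning_set[OF dim_U] by metis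
  then obtain A where A: "\<And>k. k < n \<Longrightarrow> countable (A k) \<and> A k \<subseteq> U k \<and> U.span (A k) = U k"
    by metis
  have "\<forall>k. \<exists>B. k < n \<longrightarrow> countable B \<and> B \<subseteq> V k \<and> V.span B = V k"
    using V.countable_spanning_set[OF dim_V] by metis
  then obtain B where B: "\<And>k. k < n \<Longrightarrow> countable (B k) \<and> B k \<subseteq> V k \<and> V.span (B k) = V k"
    by metis
  \<comment> \<open>\<open>Inl x\<close> demands \<open>x\<close> in the domain,
    \<open>Inr y\<close> demands \<open>y\<close> in the range.\<close>
  define D where "D = (SIGMA k:{..<n}. Inl ` A k \<union> Inr ` B k)"
  have "countable D"
    unfolding D_def using A B by (intro countable_SIGMA) auto
  define meets :: "(nat \<Rightarrow> ('a \<times> 'b) set) \<Rightarrow> nat \<times> ('a + 'b) \<Rightarrow> bool" where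
    "meets G d \<longleftrightarrow> (case d of (k, Inl x) \<Rightarrow> x \<in> Domain (G k) | (k, Inr y) \<Rightarrow> y \<in> Range (G k))" for G d
  have step: "\<exists>G'. partial_iso G' \<and> (\<forall>j. G j \<subseteq> G' j) \<and> (d \<in> D \<longrightarrow> meets G' d)"
    if G: "partial_iso G" for G d
  proof (cases "d \<in> D")
    case False
    then show ?thesis
      using G by blast
  next
    case True
    then consider (1) k x where "d = (k, Inl x)" "k < n" "x \<in> U k"
      | (2) k y where "d = (k, Inr y)" "k < n" "y \<in> V k"
      unfolding D_def using A B by blast
    then show ?thesis
    proof cases
      case 1
      then show ?thesis
        using partial_iso_extend_Domain[OF nil(1) G 1(2,3)] by (auto simp: meets_def 1(1))
    next
      case 2
      then show ?thesis
        using partial_iso_extend_Range[OF nil(2) G 2(2,3)] by (auto simp: meets_def 2(1))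
    qed
  qed
  \<comment> \<open>The guard concerns an empty \<open>D\<close>, for which
    \<open>from_nat_into\<close> returns an arbitrary value.\<close>
  define Q where "Q i G G' \<longleftrightarrow> (\<forall>j. G j \<subseteq> G' j) \<and>
    (from_nat_into D i \<in> D \<longrightarrow> meets G' (from_nat_into D i))" for i G G'
  have "\<exists>\<Phi>. \<forall>i. partial_iso (\<Phi> i) \<and> Q i (\<Phi> i) (\<Phi> (Suc i))"
  proof (rule dependent_nat_choice)
    show "\<exists>G. partial_iso G"
      using partial_iso_zero_relation by blast
    show "\<exists>G'. partial_iso G' \<and> Q i G G'" if "partial_iso G" for G i
      unfolding Q_def by (rule step[OF that])
  qed
  then obtain \<Phi> where \<Phi>: "\<And>i. partial_iso (\<Phi> i)" "\<And>i. Q i (\<Phi> i) (\<Phi> (Suc i))"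
    by blast
  define \<Gamma> where "\<Gamma> k = (\<Union>i. \<Phi> i k)" for k
  have mono: "\<Phi> i k \<subseteq> \<Phi> j k" if "i \<le> j" for i j k
  proof (rule lift_Suc_mono_le[of "\<lambda>i. \<Phi> i k", OF _ that])
    show "\<Phi> i k \<subseteq> \<Phi> (Suc i) k" for i
      using \<Phi>(2)[of i] unfolding Q_def by blast
  qed
  have met: "meets \<Gamma> d" if d: "d \<in> D" for d
  proof -
    obtain i where i: "d = from_nat_into D i"
      using from_nat_into_surj[OF \<open>countable D\<close> d] by metis
    then have "meets (\<Phi> (Suc i)) d"
      using \<Phi>(2)[of i] d by (simp add: Q_def)
    moreover have "\<Phi> (Suc i) j \<subseteq> \<Gamma> j" for j
      by (auto simp: \<Gamma>_def)
    ultimately show ?thesis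
      unfolding meets_def by (auto split: prod.splits sum.splits)
  qed
  have lin: "linear_relation scaleU scaleV (\<Gamma> k)" if k: "k < n" for k
    unfolding linear_relation_def
  proof (intro conjI allI impI)
    show "(0, 0) \<in> \<Gamma> k"
      using linear_relation_zero[OF partial_iso_linear[OF \<Phi>(1) k]] by (auto simp: \<Gamma>_def)
  next
    fix x y x' y'
    assume "(x, y) \<in> \<Gamma> k" "(x', y') \<in> \<Gamma> k"
    then obtain i j where "(x, y) \<in> \<Phi> i k" "(x', y') \<in> \<Phi> j k"
      by (auto simp: \<Gamma>_def)
    then have "(x, y) \<in> \<Phi> (max i j) k" "(x', y') \<in> \<Phi> (max i j) k"
      using mono[of i "max i j" k] mono[of j "max i j" k] by auto
    then have "(x + x', y + y') \<in> \<Phi> (max i j) k"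
      by (rule linear_relation_add[OF partial_iso_linear[OF \<Phi>(1) k]])
    then show "(x + x', y + y') \<in> \<Gamma> k"
      by (auto simp: \<Gamma>_def)
  next
    fix c x y
    assume "(x, y) \<in> \<Gamma> k"
    then show "(scaleU c x, scaleV c y) \<in> \<Gamma> k"
      using linear_relation_scale[OF partial_iso_linear[OF \<Phi>(1) k]] unfolding \<Gamma>_def by blast
  qed
  show thesis
  proof (rule that)
    fix k
    assume k: "k < n"
    show "linear_relation scaleU scaleV (\<Gamma> k)"
      by (rule lin[OF k])
    have "A k \<subseteq> Domain (\<Gamma> k)" "B k \<subseteq> Range (\<Gamma> k)"
      using met[of "(k, Inl _)"] met[of "(k, Inr _)"] k by (auto simp: D_def meets_def)
    \<comment> \<open>The range is the domain of the converse relation.\<close>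
    moreover have "V.subspace (Range (\<Gamma> k))"
    proof -
      interpret S: vector_space_pair scaleV scaleU
        by unfold_locales
      show ?thesis
        using S.subspace_Domain[of "(\<Gamma> k)\<inverse>"] lin[OF k] by (simp add: linear_relation_converse)
    qed
    ultimately have "U k \<subseteq> Domain (\<Gamma> k)" "V k \<subseteq> Range (\<Gamma> k)"
      using A[OF k] B[OF k] U.span_minimal[OF _ subspace_Domain[OF lin[OF k]], of "A k"]
        V.span_minimal[of "B k" "Range (\<Gamma> k)"] by auto
    moreover have "Domain (\<Gamma> k) \<subseteq> U k" "Range (\<Gamma> k) \<subseteq> V k"
      using partial_iso_in[OF \<Phi>(1) k] unfolding \<Gamma>_def by blast+
    ultimately show "Domain (\<Gamma> k) = U k" "Range (\<Gamma> k) = V k"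
      by auto
    fix x y
    assume "(x, y) \<in> \<Gamma> k"
    then obtain i where "(x, y) \<in> \<Phi> i k"
      by (auto simp: \<Gamma>_def)
    then show "x = 0 \<longleftrightarrow> y = 0" "(u k x, v k y) \<in> \<Gamma> ((k + 1) mod n)"
      using partial_iso_zero[OF \<Phi>(1) k, of x y i] partial_iso_next[OF \<Phi>(1) k, of x y i]
      unfolding \<Gamma>_def by blast+
  qed
qed

lemma isomorphic:
  assumes "U.locally_nilpotent" "V.locally_nilpotent"
  shows "cyclic_rep_isomorphic n scaleU U u scaleV V v"
proof -
  obtain \<Gamma> where lin: "\<And>k. k < n \<Longrightarrow> linear_relation scaleU scaleV (\<Gamma> k)"
    and dom: "\<And>k. k < n \<Longrightarrow> Domain (\<Gamma> k) = U k" and ran: "\<And>k. k < n \<Longrightarrow> Range (\<Gamma> k) = V k"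
    and zero: "\<And>k x y. k < n \<Longrightarrow> (x, y) \<in> \<Gamma> k \<Longrightarrow> x = 0 \<longleftrightarrow> y = 0"
    and nxt: "\<And>k x y. k < n \<Longrightarrow> (x, y) \<in> \<Gamma> k \<Longrightarrow> (u k x, v k y) \<in> \<Gamma> ((k + 1) mod n)"
    by (rule exists_iso_relation[OF assms]) (use that in blast)
  \<comment> \<open>A choice in form only: \<open>zero\<close>, applied to differences of pairs,
    makes partners unique.\<close>
  define \<phi> where "\<phi> k x = (SOME y. (x, y) \<in> \<Gamma> k)" for k x
  have mem: "(x, \<phi> k x) \<in> \<Gamma> k" if "k < n" "x \<in> U k" for k x
    unfolding \<phi>_def by (rule someI_ex) (use dom[OF that(1)] that(2) in blast)
  have uniq: "x = x' \<longleftrightarrow> y = y'" if "k < n" "(x, y) \<in> \<Gamma> k" "(x', y') \<in> \<Gamma> k" for k x y x' y'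
    using zero[OF that(1) linear_relation_diff[OF lin[OF that(1)] that(2,3)]] by simp
  have eq: "\<phi> k x = y" if "k < n" "(x, y) \<in> \<Gamma> k" for k x y
    using uniq[OF that(1) mem that(2)] that dom[OF that(1)] by blast
  have "linear_map_on scaleU scaleV (U k) (V k) (\<phi> k) \<and> bij_betw (\<phi> k) (U k) (V k) \<and>
      (\<forall>x\<in>U k. v k (\<phi> k x) = \<phi> ((k + 1) mod n) (u k x))" if k: "k < n" for k
  proof (intro conjI ballI)
    note L = lin[OF k]
    show "linear_map_on scaleU scaleV (U k) (V k) (\<phi> k)"
      unfolding linear_map_on_def
    proof (intro conjI ballI allI)
      fix x
      assume x: "x \<in> U k"
      show "\<phi> k x \<in> V k"
        using mem[OF k x] ran[OF k] by blast
      show "\<phi> k (scaleU c x) = scaleV c (\<phi> k x)" for c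
        by (rule eq[OF k linear_relation_scale[OF L mem[OF k x]]])
      show "\<phi> k (x + y) = \<phi> k x + \<phi> k y" if "y \<in> U k" for y
        by (rule eq[OF k linear_relation_add[OF L mem[OF k x] mem[OF k that]]])
    qed
    show "bij_betw (\<phi> k) (U k) (V k)"
      unfolding bij_betw_def
    proof
      show "inj_on (\<phi> k) (U k)"
        using uniq[OF k mem[OF k] mem[OF k]] by (auto intro: inj_onI)
      show "\<phi> k ` U k = V k"
      proof (intro equalityI subsetI)
        fix y
        assume "y \<in> \<phi> k ` U k"
        then show "y \<in> V k"
          using mem[OF k] ran[OF k] by blast
      next
        fix y
        assume "y \<in> V k"
        then obtain x where "(x, y) \<in> \<Gamma> k"
          using ran[OF k] by blast
        then show "y \<in> \<phi> k ` U k"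
          using eq[OF k] dom[OF k] by blast
      qed
    qed
    fix x
    assume "x \<in> U k"
    then show "v k (\<phi> k x) = \<phi> ((k + 1) mod n) (u k x)"
      using eq[OF U.next_less nxt[OF k mem[OF k]]] by simp
  qed
  then show ?thesis
    unfolding cyclic_rep_isomorphic_def by blast
qed

end

theorem theorem1p9:
  fixes scaleU :: "'f::field \<Rightarrow> 'a::ab_group_add \<Rightarrow> 'a"
    and scaleV :: "'f \<Rightarrow> 'b::ab_group_add \<Rightarrow> 'b"
    and n :: nat
    and U :: "nat \<Rightarrow> 'a set" and u :: "nat \<Rightarrow> 'a \<Rightarrow> 'a"
    and V :: "nat \<Rightarrow> 'b set" and v :: "nat \<Rightarrow> 'b \<Rightarrow> 'b"
  assumes "cyclic_rep scaleU n U u" and "cyclic_rep scaleV n V v"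
    and "cyclic_rep.locally_nilpotent n U u" and "cyclic_rep.locally_nilpotent n V v"
    and "cyclic_rep.dimension scaleU n U \<le>o natLeq"
    and "cyclic_rep.dimension scaleV n V \<le>o natLeq"
  shows "cyclic_rep_isomorphic n scaleU U u scaleV V v \<longleftrightarrow>
    (\<forall>k<n.
      (\<forall>\<alpha>::omega1. cyclic_rep.kappa scaleU n U u k \<alpha> =o cyclic_rep.kappa scaleV n V v k \<alpha>) \<and>
      cyclic_rep.kappa_inf scaleU n U u k =o cyclic_rep.kappa_inf scaleV n V v k)"
proof -
  interpret cyclic_rep_pair scaleU scaleV n U u V v
    using assms(1,2) by (rule cyclic_rep_pair.intro)
  show ?thesis
  proof
    assume "cyclic_rep_isomorphic n scaleU U u scaleV V v"
    then obtain \<phi> where \<phi>: "\<And>k. k < n \<Longrightarrow> linear_map_on scaleU scaleV (U k) (V k) (\<phi> k)"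
      "\<And>k. k < n \<Longrightarrow> bij_betw (\<phi> k) (U k) (V k)"
      "\<And>k x. k < n \<Longrightarrow> x \<in> U k \<Longrightarrow> v k (\<phi> k x) = \<phi> ((k + 1) mod n) (u k x)"
      unfolding cyclic_rep_isomorphic_def by blast
    show "\<forall>k<n. (\<forall>\<alpha>::omega1. U.kappa k \<alpha> =o V.kappa k \<alpha>) \<and> U.kappa_inf k =o V.kappa_inf k"
      by (auto intro: iso_kappa[OF \<phi>] iso_kappa_inf[OF \<phi>])
  next
    assume "\<forall>k<n. (\<forall>\<alpha>::omega1. U.kappa k \<alpha> =o V.kappa k \<alpha>) \<and> U.kappa_inf k =o V.kappa_inf k"
    then interpret kaplansky_pair scaleU scaleV n U u V v
      using assms(5,6) by unfold_locales auto
    show "cyclic_rep_isomorphic n scaleU U u scaleV V v"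
      using assms(3,4) by (rule isomorphic)
  qed
qed

end
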